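(* Let $\mathcal{H}$ be an essential and irreducible finite arrangement of complex linear hyperplanes $H=\{h=0\}\subset\mathbb{C}^n$, and let $\nabla=d-\sum_{H\in\mathcal{H}}A_H\,dh/h$ be a flat, torsion free, unitary standard connection such that for every $L\in\mathcal{L}_{irr}(\mathcal{H})$ the weight $a_L$ satisfies $a_L\notin\mathbb{Z}$ and $1-a_L>0$. If $g$ and $g'$ are Kähler metrics on $(\mathbb{C}^n)^\circ=\mathbb{C}^n\setminus\bigcup_{H\in\mathcal H}H$ which are parallel with respect to $\nabla$, then $g'=\lambda g$ for some constant $\lambda>0$.
   Context: Arrangements. For each $H\in\mathcal{H}$ a linear function $h$ with $H=\{h=0\}$ is fixed. $\mathcal{H}$ is essential if the common intersection of its members is $\{0\}$. $\mathcal{L}(\mathcal{H})$ is the set of all linear subspaces that are intersections of members of $\mathcal{H}$; $\mathcal{H}_L=\{H\in\mathcal{H}:L\subset H\}$. For $\mathcal{B}\subset\mathcal{H}$ let $W(\mathcal{B})\subset(\mathbb{C}^n)^*$ be the span of the linear equations of its members; $\mathcal{B}$ is reducible if it is a union of two non-empty subsets $\mathcal{B}_1,\mathcal{B}_2$ with $W(\mathcal{B})=W(\mathcal{B}_1)\oplus W(\mathcal{B}_2)$, irreducible otherwise. $\mathcal{L}_{irr}(\mathcal{H})$ is the set of $L\in\mathcal{L}(\mathcal{H})$, $L\ne\mathbb{C}^n$, with $\mathcal{H}_L$ irreducible. Connections. A standard connection is a meromorphic connection $\nabla=d-\sum_{H}A_H\,dh/h$ on $T\mathbb{C}^n$, in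 the frame of linear coordinate vector fields, with constant matrices $A_H$. It is flat, torsion free, unitary if it is so on $(\mathbb{C}^n)^\circ$ (unitary: it preserves a positive definite Hermitian inner product). The weight at $L\in\mathcal{L}_{irr}(\mathcal{H})$ is $a_L=(\operatorname{codim}L)^{-1}\sum_{H\in\mathcal{H}_L}\operatorname{tr}A_H$. *)

theory Defs
  imports "HOL-Analysis.Analysis" "HOL-Library.Function_Algebras" "HOL-Library.Complex_Order"
begin

section \<open>Hyperplane arrangements\<close>

text \<open>
  An arrangement is a finite set \<open>HH\<close> of hyperplanes of \<open>complex ^ 'n\<close>; the chosen
  linear equation of a member \<open>H\<close> is \<open>h H\<close>.
\<close>

definition arrangement ::
    "(complex ^ 'n::finite) set set \<Rightarrow> ((complex ^ 'n) set \<Rightarrow> complex ^ 'n \<Rightarrow> complex) \<Rightarrow> bool" where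
  "arrangement HH h \<longleftrightarrow> finite HH \<and>
     (\<forall>H\<in>HH. Vector_Spaces.linear (*s) (*) (h H) \<and> h H \<noteq> 0 \<and> H = {x. h H x = 0})"

definition arr_complement :: "(complex ^ 'n::finite) set set \<Rightarrow> (complex ^ 'n) set" where
  "arr_complement HH = UNIV - \<Union>HH"

definition essential :: "(complex ^ 'n::finite) set set \<Rightarrow> bool" where
  "essential HH \<longleftrightarrow> \<Inter>HH = {0}"

text \<open>The empty subfamily contributes the whole space, as \<open>\<Inter>{} = UNIV\<close>.\<close>

definition intersections :: "(complex ^ 'n::finite) set set \<Rightarrow> (complex ^ 'n) set set" where
  "intersections HH = {\<Inter>B | B. B \<subseteq> HH}"

definition localization ::
    "(complex ^ 'n::finite) set set \<Rightarrow> (complex ^ 'n) set \<Rightarrow> (complex ^ 'n) set set" where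
  "localization HH L = {H \<in> HH. L \<subseteq> H}"

text \<open>
  Functionals live in the complex vector space of all functions
  \<open>complex ^ 'n \<Rightarrow> complex\<close> with pointwise operations; spans of linear functionals
  taken there stay inside the dual space.
\<close>

definition scale_functional :: "complex \<Rightarrow> ('a \<Rightarrow> complex) \<Rightarrow> 'a \<Rightarrow> complex" where
  "scale_functional c f = (\<lambda>x. c * f x)"

interpretation functional: vector_space "scale_functional :: complex \<Rightarrow> ('a \<Rightarrow> complex) \<Rightarrow> _"
  by unfold_locales (simp_all add: scale_functional_def fun_eq_iff algebra_simps)

definition equation_span ::
    "((complex ^ 'n::finite) set \<Rightarrow> complex ^ 'n \<Rightarrow> complex) \<Rightarrow> (complex ^ 'n) set set
      \<Rightarrow> (complex ^ 'n \<Rightarrow> complex) set" where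
  "equation_span h B = functional.span (h ` B)"

definition internal_direct_sum :: "('a::ab_group_add) set \<Rightarrow> 'a set \<Rightarrow> 'a set \<Rightarrow> bool" where
  "internal_direct_sum W W1 W2 \<longleftrightarrow> W = {a + b | a b. a \<in> W1 \<and> b \<in> W2} \<and> W1 \<inter> W2 = {0}"

definition reducible ::
    "((complex ^ 'n::finite) set \<Rightarrow> complex ^ 'n \<Rightarrow> complex) \<Rightarrow> (complex ^ 'n) set set \<Rightarrow> bool" where
  "reducible h B \<longleftrightarrow> (\<exists>B1 B2. B1 \<noteq> {} \<and> B2 \<noteq> {} \<and> B = B1 \<union> B2 \<and>
     internal_direct_sum (equation_span h B) (equation_span h B1) (equation_span h B2))"

definition irreducible_intersections ::
    "(complex ^ 'n::finite) set set \<Rightarrow> ((complex ^ 'n) set \<Rightarrow> complex ^ 'n \<Rightarrow> complex)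
      \<Rightarrow> (complex ^ 'n) set set" where
  "irreducible_intersections HH h =
     {L \<in> intersections HH. L \<noteq> UNIV \<and> \<not> reducible h (localization HH L)}"


section \<open>Smooth maps and vector fields\<close>

text \<open>
  Smoothness is real \<open>C\<^sup>\<infinity>\<close> smoothness, for maps on open sets. A vector field on an open
  set \<open>U\<close> of \<open>complex ^ 'n\<close> is a section of the real tangent bundle, i.e. a map
  \<open>complex ^ 'n \<Rightarrow> complex ^ 'n\<close> of which only the values on \<open>U\<close> matter; the
  complex structure is scalar multiplication by \<open>\<i>\<close>.
\<close>

fun differentiable_times_on ::
    "nat \<Rightarrow> ('a::euclidean_space) set \<Rightarrow> ('a \<Rightarrow> 'b::real_normed_vector) \<Rightarrow> bool" where
  "differentiable_times_on 0 U f \<longleftrightarrow> continuous_on U f"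
| "differentiable_times_on (Suc k) U f \<longleftrightarrow> (\<forall>x\<in>U. f differentiable at x) \<and>
     (\<forall>v. differentiable_times_on k U (\<lambda>x. frechet_derivative f (at x) v))"

definition smooth_on ::
    "('a::euclidean_space) set \<Rightarrow> ('a \<Rightarrow> 'b::real_normed_vector) \<Rightarrow> bool" where
  "smooth_on U f \<longleftrightarrow> (\<forall>k. differentiable_times_on k U f)"

definition lie_bracket ::
    "('a::euclidean_space \<Rightarrow> 'a) \<Rightarrow> ('a \<Rightarrow> 'a) \<Rightarrow> 'a \<Rightarrow> 'a" where
  "lie_bracket X Y x = frechet_derivative Y (at x) (X x) - frechet_derivative X (at x) (Y x)"


section \<open>Standard connections\<close>

text \<open>
  The covariant derivative of \<open>Y\<close> along \<open>X\<close> for the connection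
  \<open>d - (\<Sum>H. A H dh / h)\<close>. As \<open>h H\<close> is linear, \<open>dh (X x) = h H (X x)\<close>.
\<close>

definition cov_deriv ::
    "(complex ^ 'n::finite) set set \<Rightarrow> ((complex ^ 'n) set \<Rightarrow> complex ^ 'n \<Rightarrow> complex)
      \<Rightarrow> ((complex ^ 'n) set \<Rightarrow> complex ^ 'n ^ 'n)
      \<Rightarrow> (complex ^ 'n \<Rightarrow> complex ^ 'n) \<Rightarrow> (complex ^ 'n \<Rightarrow> complex ^ 'n)
      \<Rightarrow> complex ^ 'n \<Rightarrow> complex ^ 'n" where
  "cov_deriv HH h A X Y x = frechet_derivative Y (at x) (X x)
     - (\<Sum>H\<in>HH. (h H (X x) / h H x) *s (A H *v Y x))"

definition flat_connection ::
    "(complex ^ 'n::finite) set set \<Rightarrow> ((complex ^ 'n) set \<Rightarrow> complex ^ 'n \<Rightarrow> complex)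
      \<Rightarrow> ((complex ^ 'n) set \<Rightarrow> complex ^ 'n ^ 'n) \<Rightarrow> bool" where
  "flat_connection HH h A \<longleftrightarrow>
     (let U = arr_complement HH; D = cov_deriv HH h A in
       \<forall>X Y Z. smooth_on U X \<longrightarrow> smooth_on U Y \<longrightarrow> smooth_on U Z \<longrightarrow>
         (\<forall>x\<in>U. D X (D Y Z) x - D Y (D X Z) x - D (lie_bracket X Y) Z x = 0))"

definition torsion_free ::
    "(complex ^ 'n::finite) set set \<Rightarrow> ((complex ^ 'n) set \<Rightarrow> complex ^ 'n \<Rightarrow> complex)
      \<Rightarrow> ((complex ^ 'n) set \<Rightarrow> complex ^ 'n ^ 'n) \<Rightarrow> bool" where
  "torsion_free HH h A \<longleftrightarrow>
     (let U = arr_complement HH; D = cov_deriv HH h A in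
       \<forall>X Y. smooth_on U X \<longrightarrow> smooth_on U Y \<longrightarrow>
         (\<forall>x\<in>U. D X Y x - D Y X x - lie_bracket X Y x = 0))"


section \<open>Hermitian and Kaehler metrics\<close>

text \<open>
  A Hermitian metric is given by its Hermitian forms \<open>g x u v\<close>, complex linear in \<open>u\<close>
  and conjugate linear in \<open>v\<close>; the Riemannian metric is \<open>Re (g x u v)\<close>. The order on
  \<open>complex\<close> is that of \<open>Complex_Order\<close>, so \<open>0 < z\<close> means that \<open>z\<close> is real and
  positive.
\<close>

definition hermitian_metric_on ::
    "(complex ^ 'n::finite) set \<Rightarrow> (complex ^ 'n \<Rightarrow> complex ^ 'n \<Rightarrow> complex ^ 'n \<Rightarrow> complex) \<Rightarrow> bool" where
  "hermitian_metric_on U g \<longleftrightarrow>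
     (\<forall>x\<in>U. (\<forall>v. Vector_Spaces.linear (*s) (*) (\<lambda>u. g x u v)) \<and>
            (\<forall>u v. g x v u = cnj (g x u v)) \<and>
            (\<forall>u. u \<noteq> 0 \<longrightarrow> 0 < g x u u)) \<and>
     (\<forall>u v. smooth_on U (\<lambda>x. g x u v))"

text \<open>\<open>\<omega>(u, v) = Re (g (\<i> u) v)\<close>, the Kaehler form.\<close>

definition kaehler_form ::
    "(complex ^ 'n::finite \<Rightarrow> complex ^ 'n \<Rightarrow> complex ^ 'n \<Rightarrow> complex)
      \<Rightarrow> complex ^ 'n \<Rightarrow> complex ^ 'n \<Rightarrow> complex ^ 'n \<Rightarrow> real" where
  "kaehler_form g x u v = Re (g x (\<i> *s u) v)"

text \<open>\<open>d\<omega> = 0\<close>, where \<open>d\<omega>\<close> is evaluated on constant (hence commuting) vector fields.\<close>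

definition closed_2form_on ::
    "('a::euclidean_space) set \<Rightarrow> ('a \<Rightarrow> 'a \<Rightarrow> 'a \<Rightarrow> real) \<Rightarrow> bool" where
  "closed_2form_on U \<omega> \<longleftrightarrow> (\<forall>x\<in>U. \<forall>u v w.
       frechet_derivative (\<lambda>p. \<omega> p v w) (at x) u
     + frechet_derivative (\<lambda>p. \<omega> p w u) (at x) v
     + frechet_derivative (\<lambda>p. \<omega> p u v) (at x) w = 0)"

definition kaehler_metric_on ::
    "(complex ^ 'n::finite) set \<Rightarrow> (complex ^ 'n \<Rightarrow> complex ^ 'n \<Rightarrow> complex ^ 'n \<Rightarrow> complex) \<Rightarrow> bool" where
  "kaehler_metric_on U g \<longleftrightarrow> hermitian_metric_on U g \<and> closed_2form_on U (kaehler_form g)"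

definition parallel_metric ::
    "(complex ^ 'n::finite) set set \<Rightarrow> ((complex ^ 'n) set \<Rightarrow> complex ^ 'n \<Rightarrow> complex)
      \<Rightarrow> ((complex ^ 'n) set \<Rightarrow> complex ^ 'n ^ 'n)
      \<Rightarrow> (complex ^ 'n \<Rightarrow> complex ^ 'n \<Rightarrow> complex ^ 'n \<Rightarrow> complex) \<Rightarrow> bool" where
  "parallel_metric HH h A g \<longleftrightarrow>
     (let U = arr_complement HH; D = cov_deriv HH h A in
       \<forall>X Y Z. smooth_on U X \<longrightarrow> smooth_on U Y \<longrightarrow> smooth_on U Z \<longrightarrow>
         (\<forall>x\<in>U. frechet_derivative (\<lambda>p. g p (X p) (Y p)) (at x) (Z x)
                  = g x (D Z X x) (Y x) + g x (X x) (D Z Y x)))"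

definition unitary_connection ::
    "(complex ^ 'n::finite) set set \<Rightarrow> ((complex ^ 'n) set \<Rightarrow> complex ^ 'n \<Rightarrow> complex)
      \<Rightarrow> ((complex ^ 'n) set \<Rightarrow> complex ^ 'n ^ 'n) \<Rightarrow> bool" where
  "unitary_connection HH h A \<longleftrightarrow>
     (\<exists>g. hermitian_metric_on (arr_complement HH) g \<and> parallel_metric HH h A g)"

definition weight ::
    "(complex ^ 'n::finite) set set \<Rightarrow> ((complex ^ 'n) set \<Rightarrow> complex ^ 'n ^ 'n)
      \<Rightarrow> (complex ^ 'n) set \<Rightarrow> complex" where
  "weight HH A L =
     (\<Sum>H\<in>localization HH L. trace (A H)) / of_nat (CARD('n) - vec.dim L)"

end

theory Submission
  imports Defs "HOL-Complex_Analysis.Conformal_Mappings"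
begin

text \<open>
  Write \<open>g' u v = g (P u) v\<close> for a field \<open>P\<close> of endomorphisms. Both metrics being parallel, \<open>P\<close> is
  parallel: \<open>dP = [\<Omega>, P]\<close> with \<open>\<Omega> = \<Sum> A\<^sub>H dh/h\<close> (\<open>metric_ratio_on_line\<close>). In particular \<open>P\<close> is
  holomorphic and single-valued on the complement of the arrangement. The proof shows that \<open>P\<close> is
  constant; then it commutes with every residue \<open>A\<^sub>H\<close>, and a matrix commuting with all residues is
  scalar because the arrangement is essential and irreducible (\<open>commuting_with_residues_scalar\<close>).

  The residues are controlled as follows. Vanishing torsion makes \<open>A\<^sub>H\<close> vanish on \<open>H\<close>, so
  \<open>A\<^sub>H v = h(v) n\<close>, and the trace \<open>h(n)\<close> is the weight of \<open>H\<close>, which is no integer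
  (\<open>residue_rank_one\<close>, \<open>hyperplane_irreducible_intersection\<close>). Flatness says that the values of \<open>\<Omega>\<close>
  at a point commute; the value on the Euler field is \<open>\<Sum> A\<^sub>H\<close>, which therefore commutes with every
  residue and is scalar. Hence \<open>P\<close> is constant on complex lines through the origin.

  Now restrict \<open>P\<close> to a line \<open>p + t q\<close> that meets the hyperplanes in distinct points. There it solves a
  Fuchsian system whose residues are the commutators with the \<open>A\<^sub>H\<close>, with eigenvalues \<open>0\<close> and
  \<open>\<plusminus> h(n)\<close>. Since \<open>P\<close> is single-valued it has at worst poles, and as \<open>h(n)\<close> is not an integer it has none
  (\<open>nonresonant_singularity_removable\<close>). By homogeneity \<open>P (p + t q) = P (q + p / t)\<close>, which tends to
  \<open>P q\<close> as \<open>t\<close> tends to infinity. So \<open>P\<close> is constant on the line by Liouville's theorem, whence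
  \<open>P p = P q\<close> (\<open>nonresonant_fuchsian_constant\<close>); any two points are linked by a third that is generic
  with respect to both.
\<close>

section \<open>Linear functionals\<close>

abbreviation linear_functional :: "(complex ^ 'n::finite \<Rightarrow> complex) \<Rightarrow> bool" where
  "linear_functional f \<equiv> Vector_Spaces.linear (*s) (*) f"

lemma linear_functional_simps:
  assumes "linear_functional f"
  shows "f (x + y) = f x + f y" "f (x - y) = f x - f y" "f (c *s x) = c * f x" "f 0 = 0"
proof -
  interpret Vector_Spaces.linear "(*s)" "(*)" f by fact
  show "f (x + y) = f x + f y" by (rule add)
  show "f (x - y) = f x - f y" by (rule diff)
  show "f (c *s x) = c * f x" by (rule scale)
  show "f 0 = 0" by (rule zero)
qed

lemma linear_functional_sum_axis:
  assumes "linear_functional f"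
  shows "f x = (\<Sum>i\<in>UNIV. x $ i * f (axis i 1))"
proof -
  interpret Vector_Spaces.linear "(*s)" "(*)" f by fact
  have "f x = f (\<Sum>i\<in>UNIV. x $ i *s axis i 1)"
    by (simp add: basis_expansion)
  also have "\<dots> = (\<Sum>i\<in>UNIV. x $ i * f (axis i 1))"
    by (simp add: sum scale)
  finally show ?thesis .
qed

lemma linear_functional_kernel_subset:
  assumes f: "linear_functional f" and k: "linear_functional k"
    and sub: "\<And>x. f x = 0 \<Longrightarrow> k x = 0" and u: "f u = 1"
  shows "k x = f x * k u"
proof -
  have "f (x - f x *s u) = 0"
    using u by (simp add: linear_functional_simps[OF f])
  then have "k (x - f x *s u) = 0" by (rule sub)
  then show ?thesis by (simp add: linear_functional_simps[OF k])
qed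

lemma linear_functional_normalize:
  assumes "linear_functional f" "f \<noteq> 0"
  obtains u where "f u = 1"
proof -
  obtain v where v: "f v \<noteq> 0" using assms(2) by (auto simp: fun_eq_iff)
  have "f ((1 / f v) *s v) = 1" using v by (simp add: linear_functional_simps[OF assms(1)])
  then show thesis by (rule that)
qed

text \<open>
  Induction on the number of functionals: on a line through a point that is good for all but one of
  them, in a direction on which the last one does not vanish, only finitely many parameters are bad.
\<close>

lemma common_nonvanishing_point:
  fixes F :: "(complex ^ 'n::finite \<Rightarrow> complex) set"
  assumes "finite F" and "\<And>f. f \<in> F \<Longrightarrow> linear_functional f" and "\<And>f. f \<in> F \<Longrightarrow> f \<noteq> 0"
  obtains x where "\<And>f. f \<in> F \<Longrightarrow> f x \<noteq> 0"
proof -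
  have "\<exists>x. \<forall>f\<in>F. f x \<noteq> 0"
    using assms
  proof (induction F rule: finite_induct)
    case empty
    then show ?case by simp
  next
    case (insert k F)
    then obtain x where x: "\<forall>f\<in>F. f x \<noteq> 0" by auto
    have k: "linear_functional k" using insert.prems by blast
    obtain y where y: "k y = 1"
      using linear_functional_normalize[OF k] insert.prems(2) by blast
    define T where "T = insert (- k x) ((\<lambda>f. - f x / f y) ` F)"
    have "finite T" using insert.hyps by (simp add: T_def)
    then obtain t where t: "t \<notin> T" using ex_new_if_finite infinite_UNIV_char_0 by blast
    have "k (x + t *s y) \<noteq> 0"
    proof
      assume "k (x + t *s y) = 0"
      then have "t = - k x" using y by (simp add: linear_functional_simps[OF k] eq_neg_iff_add_eq_0 add.commute)
      then show False using t by (simp add: T_def)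
    qed
    moreover have "f (x + t *s y) \<noteq> 0" if f: "f \<in> F" for f
    proof -
      have l: "linear_functional f" using insert.prems f by blast
      show ?thesis
      proof (cases "f y = 0")
        case True
        then show ?thesis using x f by (simp add: linear_functional_simps[OF l])
      next
        case False
        have "t \<noteq> - f x / f y" using t f by (auto simp: T_def)
        moreover have "t = - f x / f y" if "f (x + t *s y) = 0"
        proof -
          have "t * f y = - f x"
            using that by (simp add: linear_functional_simps[OF l] eq_neg_iff_add_eq_0 add.commute)
          then show ?thesis using False by (metis nonzero_mult_div_cancel_right)
        qed
        ultimately show ?thesis by blast
      qed
    qed
    ultimately show ?case by blast
  qed
  then show thesis using that by blast
qed

section \<open>Arrangements\<close>

lemma arrangementD:
  assumes "arrangement HH h"
  shows "finite HH" and "H \<in> HH \<Longrightarrow> linear_functional (h H)" and "H \<in> HH \<Longrightarrow> h H \<noteq> 0"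
    and "H \<in> HH \<Longrightarrow> x \<in> H \<longleftrightarrow> h H x = 0"
  using assms unfolding arrangement_def by auto

lemma arr_complement_iff:
  assumes "arrangement HH h"
  shows "x \<in> arr_complement HH \<longleftrightarrow> (\<forall>H\<in>HH. h H x \<noteq> 0)"
  using arrangementD(4)[OF assms] by (auto simp: arr_complement_def)

lemma hyperplane_subset_imp_eq:
  assumes arr: "arrangement HH h" and H: "H \<in> HH" "K \<in> HH" and sub: "H \<subseteq> K"
  shows "H = K"
proof -
  note l = arrangementD(2)[OF arr]
  obtain u where u: "h H u = 1"
    using linear_functional_normalize[OF l[OF H(1)] arrangementD(3)[OF arr H(1)]] .
  have eq: "h K x = h H x * h K u" for x
    using linear_functional_kernel_subset[OF l[OF H(1)] l[OF H(2)] _ u] sub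
      arrangementD(4)[OF arr] H by blast
  have "h K u \<noteq> 0"
  proof
    assume "h K u = 0"
    then have "h K = 0" using eq by (metis mult_zero_right ext zero_fun_apply)
    then show False using arrangementD(3)[OF arr H(2)] by simp
  qed
  then have "h K x = 0 \<longleftrightarrow> h H x = 0" for x
    using eq[of x] by simp
  then show ?thesis
    using arrangementD(4)[OF arr] H by blast
qed

text \<open>
  Two points span a generic pencil when the line \<open>p + t q\<close> crosses distinct hyperplanes at distinct
  parameters. For a fixed \<open>q\<close> off the arrangement each of the conditions on \<open>p\<close> is the nonvanishing of a
  nonzero functional, so a single \<open>p\<close> can be generic with respect to several points \<open>q\<close>.
\<close>

definition generic_pair ::
    "(complex ^ 'n::finite) set set \<Rightarrow> ((complex ^ 'n) set \<Rightarrow> complex ^ 'n \<Rightarrow> complex)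
      \<Rightarrow> complex ^ 'n \<Rightarrow> complex ^ 'n \<Rightarrow> bool" where
  "generic_pair HH h p q \<longleftrightarrow> p \<in> arr_complement HH \<and> q \<in> arr_complement HH \<and>
     (\<forall>H\<in>HH. \<forall>K\<in>HH. H \<noteq> K \<longrightarrow> h H p * h K q \<noteq> h K p * h H q)"

lemma generic_point_exists:
  assumes arr: "arrangement HH h" and Q: "finite Q" "Q \<subseteq> arr_complement HH"
  obtains p where "p \<in> arr_complement HH" "\<And>q. q \<in> Q \<Longrightarrow> generic_pair HH h p q"
proof -
  note l = arrangementD(2)[OF arr]
  define m where "m H K q = (\<lambda>p. h H p * h K q - h K p * h H q)" for H K q
  define F where "F = h ` HH \<union> (\<lambda>(H, K, q). m H K q) ` {(H, K, q). H \<in> HH \<and> K \<in> HH \<and> H \<noteq> K \<and> q \<in> Q}"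
  have lm: "linear_functional (m H K q)" if "H \<in> HH" "K \<in> HH" for H K q
    unfolding m_def
    using l[OF that(1)] l[OF that(2)]
    by unfold_locales (simp_all add: linear_functional_simps algebra_simps)
  have nz: "m H K q \<noteq> 0" if "H \<in> HH" "K \<in> HH" "H \<noteq> K" "q \<in> Q" for H K q
  proof
    assume z: "m H K q = 0"
    have q: "h H q \<noteq> 0" "h K q \<noteq> 0" using that Q arr_complement_iff[OF arr] by auto
    have "h H p * h K q = h K p * h H q" for p
      using fun_cong[OF z, of p] by (simp add: m_def)
    then have "H \<subseteq> K"
      using q arrangementD(4)[OF arr] that by (metis mult_eq_0_iff subsetI)
    then show False using hyperplane_subset_imp_eq[OF arr] that by blast
  qed
  have "finite {(H, K, q). H \<in> HH \<and> K \<in> HH \<and> H \<noteq> K \<and> q \<in> Q}"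
    by (rule finite_subset[of _ "HH \<times> HH \<times> Q"]) (use arrangementD(1)[OF arr] Q in auto)
  then have "finite F" using arrangementD(1)[OF arr] by (simp add: F_def)
  moreover have "linear_functional f" "f \<noteq> 0" if "f \<in> F" for f
    using that l lm arrangementD(3)[OF arr] by (auto simp: F_def dest: nz)
  ultimately obtain p where p: "\<And>f. f \<in> F \<Longrightarrow> f p \<noteq> 0"
    using common_nonvanishing_point by blast
  have pc: "p \<in> arr_complement HH"
    using p by (auto simp: arr_complement_iff[OF arr] F_def)
  have "h H p * h K q \<noteq> h K p * h H q" if "H \<in> HH" "K \<in> HH" "H \<noteq> K" "q \<in> Q" for H K q
  proof -
    have "m H K q \<in> F" using that by (force simp: F_def)
    from p[OF this] show ?thesis by (simp add: m_def)
  qed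
  then have "generic_pair HH h p q" if "q \<in> Q" for q
    unfolding generic_pair_def using pc subsetD[OF Q(2) that] that by simp
  with pc show thesis by (rule that)
qed

text \<open>Along a line \<open>p + t q\<close> the form \<open>dh/h\<close> becomes \<open>dt / (t - s)\<close> where \<open>s\<close> is this parameter.\<close>

definition crossing :: "('a \<Rightarrow> complex) \<Rightarrow> 'a \<Rightarrow> 'a \<Rightarrow> complex" where
  "crossing f p q = - f p / f q"

lemma log_form_on_line:
  assumes "linear_functional f" "f q \<noteq> 0"
  shows "f q / f (p + t *s q) = 1 / (t - crossing f p q)"
    and "f (p + t *s q) = 0 \<longleftrightarrow> t = crossing f p q"
proof -
  have *: "f (p + t *s q) = f q * (t - crossing f p q)"
    unfolding linear_functional_simps[OF assms(1)] crossing_def right_diff_distrib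
    using assms(2) by (simp add: mult.commute)
  show "f q / f (p + t *s q) = 1 / (t - crossing f p q)"
    unfolding * using assms(2) by simp
  show "f (p + t *s q) = 0 \<longleftrightarrow> t = crossing f p q"
    unfolding * using assms(2) by simp
qed

lemma inj_on_crossing:
  assumes "arrangement HH h" "generic_pair HH h p q"
  shows "inj_on (\<lambda>H. crossing (h H) p q) HH"
proof (rule inj_onI, rule ccontr)
  fix H K assume *: "H \<in> HH" "K \<in> HH" "crossing (h H) p q = crossing (h K) p q" "H \<noteq> K"
  then have "h H q \<noteq> 0" "h K q \<noteq> 0"
    using assms by (auto simp: generic_pair_def arr_complement_iff)
  then have "h H p * h K q = h K p * h H q" using *(3) by (simp add: crossing_def field_simps)
  then show False using * assms(2) by (auto simp: generic_pair_def)
qed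

lemma eventually_notin_finite:
  fixes x :: "'a::t1_space"
  assumes "finite S"
  shows "\<forall>\<^sub>F t in at x. t \<notin> S"
proof -
  have "\<forall>\<^sub>F t in at x. t \<notin> S - {x}"
    unfolding eventually_at_topological
  proof (intro exI conjI ballI impI)
    show "open (- (S - {x}))"
      by (intro open_Compl finite_imp_closed finite_Diff assms)
  qed auto
  with eventually_neq_at_within[of x x UNIV] show ?thesis
    by eventually_elim auto
qed

lemma residue_limit:
  fixes c :: "'a \<Rightarrow> complex"
  assumes "finite I" "inj_on s I" "i \<in> I"
  shows "((\<lambda>t. (t - s i) * (\<Sum>j\<in>I. c j / (t - s j))) \<longlongrightarrow> c i) (at (s i))"
proof -
  have "((\<lambda>t. c i + (t - s i) * (\<Sum>j\<in>I - {i}. c j / (t - s j))) \<longlongrightarrow>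
          c i + (s i - s i) * (\<Sum>j\<in>I - {i}. c j / (s i - s j))) (at (s i))"
    by (intro tendsto_intros) (use assms in \<open>auto dest: inj_onD\<close>)
  moreover have "\<forall>\<^sub>F t in at (s i). c i + (t - s i) * (\<Sum>j\<in>I - {i}. c j / (t - s j)) =
      (t - s i) * (\<Sum>j\<in>I. c j / (t - s j))"
    using eventually_neq_at_within[of "s i" "s i" UNIV]
    by eventually_elim (simp add: sum.remove[OF assms(1,3)] distrib_left)
  ultimately show ?thesis
    by (simp add: Lim_transform_eventually)
qed

text \<open>On a generic line the forms have simple poles at distinct points, so residues separate them.\<close>

lemma log_forms_independent:
  assumes arr: "arrangement HH h"
    and zero: "\<And>x. x \<in> arr_complement HH \<Longrightarrow> (\<Sum>H\<in>HH. c H / h H x) = 0" and H: "H \<in> HH"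
  shows "c H = 0"
proof -
  note l = arrangementD(2)[OF arr]
  obtain q where q: "q \<in> arr_complement HH"
    using generic_point_exists[OF arr, of "{}"] by auto
  obtain p where gen: "generic_pair HH h p q"
    using generic_point_exists[OF arr, of "{q}"] q by auto
  have hq: "h K q \<noteq> 0" if "K \<in> HH" for K using q that by (simp add: arr_complement_iff[OF arr])
  define s where "s K = crossing (h K) p q" for K
  have inj: "inj_on s HH" using inj_on_crossing[OF arr gen] by (simp add: s_def[abs_def])
  have fin: "finite (s ` HH)" using arrangementD(1)[OF arr] by simp
  have "\<forall>\<^sub>F t in at (s H). (t - s H) * (\<Sum>K\<in>HH. (c K / h K q) / (t - s K)) = 0"
    using eventually_notin_finite[OF fin, of "s H"]
  proof eventually_elim
    case (elim t)
    have "p + t *s q \<in> arr_complement HH"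
      using elim log_form_on_line(2)[OF l hq] by (auto simp: arr_complement_iff[OF arr] s_def)
    then have "(\<Sum>K\<in>HH. c K / h K (p + t *s q)) = 0" by (rule zero)
    moreover have "c K / h K (p + t *s q) = c K / h K q / (t - s K)" if "K \<in> HH" for K
    proof -
      have "c K / h K (p + t *s q) = c K / h K q * (h K q / h K (p + t *s q))"
        using hq[OF that] by simp
      also have "\<dots> = c K / h K q / (t - s K)"
        unfolding log_form_on_line(1)[OF l hq, OF that that] by (simp add: s_def)
      finally show ?thesis .
    qed
    ultimately show ?case by simp
  qed
  then have lim: "((\<lambda>t. (t - s H) * (\<Sum>K\<in>HH. (c K / h K q) / (t - s K))) \<longlongrightarrow> 0) (at (s H))"
    by (simp add: tendsto_eventually)
  have "((\<lambda>t. (t - s H) * (\<Sum>K\<in>HH. (c K / h K q) / (t - s K))) \<longlongrightarrow> c H / h H q) (at (s H))"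
    by (rule residue_limit) (use arrangementD(1)[OF arr] inj H in auto)
  from tendsto_unique[OF _ this lim] have "c H / h H q = 0"
    by simp
  then show ?thesis using hq[OF H] by simp
qed

section \<open>Complex matrices\<close>

lemma matrix_mult_nth: "(A ** B) $ i $ j = (\<Sum>k\<in>UNIV. A $ i $ k * B $ k $ j)"
  by (simp add: matrix_matrix_mult_def)

lemma bounded_bilinear_matrix_mult:
  "bounded_bilinear ((**) :: complex ^ 'n::finite ^ 'n \<Rightarrow> complex ^ 'n ^ 'n \<Rightarrow> complex ^ 'n ^ 'n)"
  unfolding bilinear_conv_bounded_bilinear[symmetric] bilinear_def
  by (intro conjI allI linearI)
     (simp_all add: vec_eq_iff matrix_mult_nth sum.distrib distrib_left distrib_right scaleR_sum_right)

interpretation matrix_mult: bounded_bilinear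
  "(**) :: complex ^ 'n::finite ^ 'n \<Rightarrow> complex ^ 'n ^ 'n \<Rightarrow> complex ^ 'n ^ 'n"
  by (rule bounded_bilinear_matrix_mult)

definition cscale :: "complex \<Rightarrow> complex ^ 'n ^ 'n \<Rightarrow> complex ^ 'n::finite ^ 'n" where
  "cscale c A = (\<chi> i j. c * A $ i $ j)"

lemma cscale_nth [simp]: "cscale c A $ i $ j = c * A $ i $ j"
  by (simp add: cscale_def)

lemma matrix_mult_cscale: "A ** cscale c B = cscale c (A ** B)" "cscale c A ** B = cscale c (A ** B)"
  by (simp_all add: vec_eq_iff matrix_mult_nth sum_distrib_left mult.left_commute mult.assoc)

lemma cscale_diff: "cscale c (A - B) = cscale c A - cscale c B"
  by (simp add: vec_eq_iff algebra_simps)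

lemma norm_cscale: "norm (cscale c A) = norm c * norm A"
  by (simp add: norm_vec_def cscale_def norm_mult L2_set_right_distrib[symmetric])

lemma matrix_tendsto_iff:
  fixes f :: "'a \<Rightarrow> complex ^ 'n::finite ^ 'n"
  shows "tendsto f L F \<longleftrightarrow> (\<forall>i j. tendsto (\<lambda>x. f x $ i $ j) (L $ i $ j) F)"
proof
  show "\<forall>i j. tendsto (\<lambda>x. f x $ i $ j) (L $ i $ j) F" if "tendsto f L F"
    using that by (intro allI tendsto_vec_nth)
  show "tendsto f L F" if "\<forall>i j. tendsto (\<lambda>x. f x $ i $ j) (L $ i $ j) F"
    using that by (intro vec_tendstoI) blast
qed

definition commutator :: "complex ^ 'n ^ 'n \<Rightarrow> complex ^ 'n ^ 'n \<Rightarrow> complex ^ 'n::finite ^ 'n" where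
  "commutator A B = A ** B - B ** A"

lemma commutator_cscale: "commutator A (cscale c B) = cscale c (commutator A B)"
  "commutator (cscale c A) B = cscale c (commutator A B)"
  by (simp_all add: commutator_def matrix_mult_cscale cscale_diff)

lemma commutator_sum: "commutator (\<Sum>i\<in>I. A i) B = (\<Sum>i\<in>I. commutator (A i) B)"
  by (simp add: commutator_def matrix_mult.sum_left matrix_mult.sum_right sum_subtractf)

lemma tendsto_commutator [tendsto_intros]:
  "(f \<longlongrightarrow> A) F \<Longrightarrow> (g \<longlongrightarrow> B) F \<Longrightarrow> ((\<lambda>x. commutator (f x) (g x)) \<longlongrightarrow> commutator A B) F"
  unfolding commutator_def by (intro tendsto_intros matrix_mult.tendsto)

lemma norm_commutator_le:
  obtains K where "K > 0"
    "\<And>(A :: complex ^ 'n::finite ^ 'n) B. norm (commutator A B) \<le> norm A * norm B * K"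
proof -
  obtain K where K: "K > 0" "\<And>(A :: complex ^ 'n ^ 'n) (B :: complex ^ 'n ^ 'n). norm (A ** B) \<le> norm A * norm B * K"
    using bounded_bilinear.pos_bounded[OF bounded_bilinear_matrix_mult[where 'n = 'n]] by auto
  have "norm (commutator A B) \<le> norm A * norm B * (2 * K)" for A :: "complex ^ 'n ^ 'n" and B :: "complex ^ 'n ^ 'n"
  proof -
    have "norm (B ** A) \<le> norm A * norm B * K" using K(2)[of B A] by (simp add: mult.commute)
    then have "norm (A ** B - B ** A) \<le> norm A * norm B * K + norm A * norm B * K"
      using norm_triangle_ineq4[of "A ** B" "B ** A"] K(2)[of A B] by linarith
    then show ?thesis by (simp add: commutator_def mult_ac)
  qed
  with K(1) show thesis by (intro that[of "2 * K"]) auto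
qed

section \<open>Isolated singularities of a Fuchsian commutator equation\<close>

text \<open>
  Moderate growth: along a ray into the singular point, \<open>x\<^sup>2\<^sup>N \<bar>P\<bar>\<^sup>2\<close> does not decrease with the distance \<open>x\<close>,
  so it is bounded by its values on a circle.
\<close>

lemma moderate_growth:
  fixes P W :: "complex \<Rightarrow> complex ^ 'n::finite ^ 'n"
  assumes r: "r > 0"
    and der: "\<And>t i j. \<lbrakk>t \<noteq> s; dist t s < r\<rbrakk> \<Longrightarrow> ((\<lambda>t. P t $ i $ j) has_field_derivative W t $ i $ j) (at t)"
    and bound: "\<And>t. \<lbrakk>t \<noteq> s; dist t s < r\<rbrakk> \<Longrightarrow> norm (W t) * norm (t - s) \<le> real N * norm (P t)"
  shows "\<exists>B. \<forall>\<^sub>F t in at s. norm (t - s) ^ N * norm (P t) \<le> B"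
proof -
  define R where "R = r / 2"
  have R: "0 < R" "R < r" using r by (auto simp: R_def)
  have "continuous_on (sphere s R) P"
  proof (rule continuous_at_imp_continuous_on, rule ballI)
    fix t assume "t \<in> sphere s R"
    then have t: "t \<noteq> s" "dist t s < r" using R by (auto simp: dist_commute)
    have "isCont (\<lambda>t. P t $ i $ j) t" for i j
      using der[OF t] DERIV_isCont by blast
    then show "isCont P t"
      by (simp add: isCont_def matrix_tendsto_iff)
  qed
  then have "bounded (P ` sphere s R)"
    by (intro compact_imp_bounded compact_continuous_image) auto
  then obtain B where B: "\<And>t. t \<in> sphere s R \<Longrightarrow> norm (P t) \<le> B"
    unfolding bounded_iff by (metis imageI)
  have "norm (t - s) ^ N * norm (P t) \<le> R ^ N * B" if t: "t \<noteq> s" "dist t s < R" for t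
  proof -
    define x0 where "x0 = norm (t - s)"
    define u where "u = (t - s) / of_real x0"
    have x0: "0 < x0" "x0 < R" using t by (auto simp: x0_def dist_norm)
    have u: "norm u = 1" using x0 by (simp add: u_def norm_divide x0_def)
    define \<gamma> where "\<gamma> x = s + of_real x * u" for x
    have \<gamma>0: "\<gamma> x0 = t" using x0 by (simp add: \<gamma>_def u_def)
    have \<gamma>n: "norm (\<gamma> x - s) = x" if "x > 0" for x using that u by (simp add: \<gamma>_def norm_mult)
    define \<phi> where "\<phi> x = x ^ (2 * N) * (\<Sum>i\<in>UNIV. \<Sum>j\<in>UNIV. P (\<gamma> x) $ i $ j \<bullet> P (\<gamma> x) $ i $ j)" for x
    have \<phi>: "\<phi> x = (x ^ N * norm (P (\<gamma> x)))\<^sup>2" for x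
      by (simp add: \<phi>_def power_mult_distrib power_even_eq dot_square_norm[symmetric] inner_vec_def)
    have "\<phi> x0 \<le> \<phi> R"
    proof (rule DERIV_nonneg_imp_nondecreasing[of x0 R \<phi>])
      show "x0 \<le> R" using x0 by simp
      fix x assume x: "x0 \<le> x" "x \<le> R"
      have xpos: "x > 0" using x x0 by simp
      have ne: "\<gamma> x \<noteq> s" "dist (\<gamma> x) s < r"
        using \<gamma>n[OF xpos] xpos x R by (auto simp: dist_norm)
      define V where "V = cscale u (W (\<gamma> x))"
      have \<gamma>': "(\<gamma> has_vector_derivative u) (at x)"
        unfolding \<gamma>_def by (auto intro!: derivative_eq_intros)
      have P': "((\<lambda>x. P (\<gamma> x) $ i $ j) has_vector_derivative V $ i $ j) (at x)" for i j
        using field_vector_diff_chain_at[OF \<gamma>' der[OF ne, of i j]]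
        by (simp add: o_def V_def)
      have in': "((\<lambda>x. P (\<gamma> x) $ i $ j \<bullet> P (\<gamma> x) $ i $ j) has_real_derivative
          2 * (P (\<gamma> x) $ i $ j \<bullet> V $ i $ j)) (at x)" for i j
        unfolding has_field_derivative_def
        by (rule has_derivative_eq_rhs,
            rule has_derivative_inner[OF P'[unfolded has_vector_derivative_def] P'[unfolded has_vector_derivative_def]])
           (simp add: fun_eq_iff inner_commute algebra_simps)
      have "(\<phi> has_real_derivative
          real (2 * N) * x ^ (2 * N - 1) * (\<Sum>i\<in>UNIV. \<Sum>j\<in>UNIV. P (\<gamma> x) $ i $ j \<bullet> P (\<gamma> x) $ i $ j)
          + x ^ (2 * N) * (\<Sum>i\<in>UNIV. \<Sum>j\<in>UNIV. 2 * (P (\<gamma> x) $ i $ j \<bullet> V $ i $ j))) (at x)"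
        unfolding \<phi>_def
        by (rule derivative_eq_intros in' refl | simp)+
      moreover have "(\<Sum>i\<in>UNIV. \<Sum>j\<in>UNIV. P (\<gamma> x) $ i $ j \<bullet> P (\<gamma> x) $ i $ j) = (norm (P (\<gamma> x)))\<^sup>2"
        by (simp add: dot_square_norm[symmetric] inner_vec_def)
      moreover have "(\<Sum>i\<in>UNIV. \<Sum>j\<in>UNIV. 2 * (P (\<gamma> x) $ i $ j \<bullet> V $ i $ j)) = 2 * (P (\<gamma> x) \<bullet> V)"
        by (simp add: inner_vec_def sum_distrib_left)
      moreover have "0 \<le> real (2 * N) * x ^ (2 * N - 1) * (norm (P (\<gamma> x)))\<^sup>2 + x ^ (2 * N) * (2 * (P (\<gamma> x) \<bullet> V))"
      proof (cases "N = 0")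
        case True
        then have "norm (W (\<gamma> x)) * norm (\<gamma> x - s) \<le> 0"
          using bound[OF ne] by simp
        then have "norm V = 0"
          using ne by (simp add: mult_le_0_iff V_def norm_cscale)
        then have "V = 0" by simp
        then show ?thesis using True by simp
      next
        case False
        have "norm V * x \<le> real N * norm (P (\<gamma> x))"
          using bound[OF ne] \<gamma>n[OF xpos] u by (simp add: V_def norm_cscale)
        then have "norm (P (\<gamma> x)) * (norm V * x) \<le> norm (P (\<gamma> x)) * (real N * norm (P (\<gamma> x)))"
          by (intro mult_left_mono) auto
        moreover have "- (P (\<gamma> x) \<bullet> V) * x \<le> norm (P (\<gamma> x)) * norm V * x"
          using Cauchy_Schwarz_ineq2[of "P (\<gamma> x)" V] xpos by (intro mult_right_mono) auto
        ultimately have "0 \<le> real N * (norm (P (\<gamma> x)))\<^sup>2 + x * (P (\<gamma> x) \<bullet> V)"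
          by (simp add: power2_eq_square algebra_simps)
        then have "0 \<le> (2 * x ^ (2 * N - 1)) * (real N * (norm (P (\<gamma> x)))\<^sup>2 + x * (P (\<gamma> x) \<bullet> V))"
          using xpos by (intro mult_nonneg_nonneg) auto
        also have "x ^ (2 * N) = x * x ^ (2 * N - 1)"
          using False by (simp add: power_eq_if)
        then have "(2 * x ^ (2 * N - 1)) * (real N * (norm (P (\<gamma> x)))\<^sup>2 + x * (P (\<gamma> x) \<bullet> V)) =
          real (2 * N) * x ^ (2 * N - 1) * (norm (P (\<gamma> x)))\<^sup>2 + x ^ (2 * N) * (2 * (P (\<gamma> x) \<bullet> V))"
          by (simp add: algebra_simps)
        finally show ?thesis .
      qed
      ultimately show "\<exists>y. (\<phi> has_real_derivative y) (at x) \<and> 0 \<le> y" by auto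
    qed
    then have "x0 ^ N * norm (P t) \<le> R ^ N * norm (P (\<gamma> R))"
      unfolding \<phi> \<gamma>0 by (rule power2_le_imp_le) (use R in auto)
    also have "\<dots> \<le> R ^ N * B"
    proof (intro mult_left_mono B)
      show "\<gamma> R \<in> sphere s R" using \<gamma>n[OF R(1)] by (simp add: dist_norm norm_minus_commute)
    qed (use R in auto)
    finally show ?thesis by (simp add: x0_def)
  qed
  then have "\<forall>\<^sub>F t in at s. norm (t - s) ^ N * norm (P t) \<le> R ^ N * B"
    unfolding eventually_at using R(1) by blast
  then show ?thesis by blast
qed

lemma bounded_entries_extend:
  fixes Q :: "complex \<Rightarrow> complex ^ 'n::finite ^ 'n"
  assumes r: "r > 0" and hol: "\<And>i j. (\<lambda>t. Q t $ i $ j) holomorphic_on ball s r - {s}"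
    and bd: "\<forall>\<^sub>F t in at s. norm (Q t) \<le> B"
  obtains F where "\<And>i j. F i j holomorphic_on ball s r"
    and "\<And>i j t. t \<in> ball s r - {s} \<Longrightarrow> F i j t = Q t $ i $ j"
proof -
  have "\<exists>g. g holomorphic_on ball s r \<and> (\<forall>t\<in>ball s r - {s}. g t = Q t $ i $ j)" for i j
  proof (subst holomorphic_on_extend_bounded[OF hol])
    show "s \<in> interior (ball s r)" using r by simp
    have "norm (Q t $ i $ j) \<le> norm (Q t)" for t
      using Finite_Cartesian_Product.norm_nth_le[of "Q t $ i" j] Finite_Cartesian_Product.norm_nth_le[of "Q t" i] by linarith
    with bd show "\<exists>B. \<forall>\<^sub>F t in at s. norm (Q t $ i $ j) \<le> B"
      by (intro exI[of _ B]) (auto elim!: eventually_mono intro: order_trans)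
  qed
  then show thesis using that by metis
qed

text \<open>
  At a simple pole with residue \<open>M\<close> a single-valued solution of \<open>P' = [C/(t - s), P]\<close> has at most a
  pole, and the coefficient \<open>X\<close> of \<open>(t - s)\<^sup>-\<^sup>k\<close> of highest order satisfies \<open>k X + [M, X] = 0\<close>. If no
  nonzero \<open>X\<close> does so, the order is zero.
\<close>

lemma nonresonant_singularity_removable:
  fixes P C :: "complex \<Rightarrow> complex ^ 'n::finite ^ 'n"
  assumes der: "\<forall>\<^sub>F t in at s. \<forall>i j. ((\<lambda>t. P t $ i $ j) has_field_derivative
      commutator (C t) (P t) $ i $ j / (t - s)) (at t)"
    and C: "(C \<longlongrightarrow> M) (at s)"
    and nonres: "\<And>k X. \<lbrakk>k > 0; real k *\<^sub>R X + commutator M X = 0\<rbrakk> \<Longrightarrow> X = 0"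
  shows "\<exists>L. (P \<longlongrightarrow> L) (at s)"
proof -
  have "\<forall>\<^sub>F t in at s. norm (C t) < norm M + 1"
    using tendsto_norm[OF C] by (rule order_tendstoD) simp
  with der have "\<forall>\<^sub>F t in at s. (\<forall>i j. ((\<lambda>t. P t $ i $ j) has_field_derivative
      commutator (C t) (P t) $ i $ j / (t - s)) (at t)) \<and> norm (C t) < norm M + 1"
    by (rule eventually_conj)
  then obtain r where r: "r > 0" and
    der': "\<And>t i j. \<lbrakk>t \<noteq> s; dist t s < r\<rbrakk> \<Longrightarrow> ((\<lambda>t. P t $ i $ j) has_field_derivative
      commutator (C t) (P t) $ i $ j / (t - s)) (at t)" and
    Cb: "\<And>t. \<lbrakk>t \<noteq> s; dist t s < r\<rbrakk> \<Longrightarrow> norm (C t) < norm M + 1"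
    unfolding eventually_at by auto
  have hol: "(\<lambda>t. P t $ i $ j) holomorphic_on ball s r - {s}" for i j
  proof (rule holomorphic_onI)
    fix t assume "t \<in> ball s r - {s}"
    then have "t \<noteq> s" "dist t s < r" by (auto simp: dist_commute)
    from der'[OF this] show "(\<lambda>t. P t $ i $ j) field_differentiable at t within ball s r - {s}"
      unfolding field_differentiable_def by (blast intro: has_field_derivative_at_within)
  qed

  \<comment> \<open>Induction lowers the pole order, one vanishing leading coefficient at a time.\<close>
  have pole: "\<exists>L. (P \<longlongrightarrow> L) (at s)" if "\<exists>B. \<forall>\<^sub>F t in at s. norm (t - s) ^ N * norm (P t) \<le> B" for N
    using that
  proof (induction N)
    case 0
    then obtain B where "\<forall>\<^sub>F t in at s. norm (P t) \<le> B" by auto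
    then obtain F where F: "\<And>i j. F i j holomorphic_on ball s r"
      "\<And>i j t. t \<in> ball s r - {s} \<Longrightarrow> F i j t = P t $ i $ j"
      using bounded_entries_extend[OF r hol] by metis
    have "((\<lambda>t. P t $ i $ j) \<longlongrightarrow> F i j s) (at s)" for i j
    proof (rule Lim_transform_within_open[of "F i j" _ _ _ "ball s r"])
      have "isCont (F i j) s"
        using F(1) r holomorphic_on_imp_continuous_on continuous_on_eq_continuous_at by (metis centre_in_ball open_ball)
      then show "(F i j \<longlongrightarrow> F i j s) (at s)" by (simp add: isCont_def)
    qed (use F(2) r in auto)
    then have "(P \<longlongrightarrow> (\<chi> i j. F i j s)) (at s)"
      by (simp add: matrix_tendsto_iff)
    then show ?case by blast
  next
    case (Suc N)
    then obtain B where B: "\<forall>\<^sub>F t in at s. norm (t - s) ^ Suc N * norm (P t) \<le> B" by auto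
    define Q where "Q t = cscale ((t - s) ^ Suc N) (P t)" for t
    have holQ: "(\<lambda>t. Q t $ i $ j) holomorphic_on ball s r - {s}" for i j
      unfolding Q_def cscale_nth by (intro holomorphic_intros hol)
    have "\<forall>\<^sub>F t in at s. norm (Q t) \<le> B"
      using B by (simp add: Q_def norm_cscale norm_power norm_mult)
    then obtain F where F: "\<And>i j. F i j holomorphic_on ball s r"
      "\<And>i j t. t \<in> ball s r - {s} \<Longrightarrow> F i j t = Q t $ i $ j"
      using bounded_entries_extend[OF r holQ] by metis
    define X where "X = (\<chi> i j. F i j s)"
    have contF: "isCont (F i j) s" for i j
      using F(1) r holomorphic_on_imp_continuous_on continuous_on_eq_continuous_at by (metis centre_in_ball open_ball)
    have QX: "(Q \<longlongrightarrow> X) (at s)"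
      unfolding matrix_tendsto_iff
    proof (intro allI)
      fix i j
      show "((\<lambda>t. Q t $ i $ j) \<longlongrightarrow> X $ i $ j) (at s)"
        by (rule Lim_transform_within_open[of "F i j" _ _ _ "ball s r"])
           (use contF[of i j] F(2) r in \<open>auto simp: X_def isCont_def\<close>)
    qed
    have "X = 0"
    proof (rule nonres)
      show "Suc N > 0" by simp
      have "real (Suc N) *\<^sub>R X $ i $ j + commutator M X $ i $ j = 0" for i j
      proof -
        have d0: "((\<lambda>t. (t - s) * deriv (F i j) t) \<longlongrightarrow> (s - s) * deriv (F i j) s) (at s)"
        proof (intro tendsto_intros)
          have "deriv (F i j) holomorphic_on ball s r" using F(1) by (intro holomorphic_deriv) auto
          then show "(deriv (F i j) \<longlongrightarrow> deriv (F i j) s) (at s)"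
            using r holomorphic_on_imp_continuous_on continuous_on_eq_continuous_at isCont_def
            by (metis centre_in_ball open_ball)
        qed
        have d1: "(t - s) * deriv (F i j) t =
            of_nat (Suc N) * Q t $ i $ j + commutator (C t) (Q t) $ i $ j"
          if t: "t \<in> ball s r" "t \<noteq> s" for t
        proof -
          have t': "dist t s < r" using t by (simp add: dist_commute)
          have "((\<lambda>t. Q t $ i $ j) has_field_derivative
            of_nat (Suc N) * (t - s) ^ N * P t $ i $ j + (t - s) ^ Suc N * (commutator (C t) (P t) $ i $ j / (t - s))) (at t)"
            unfolding Q_def cscale_nth
            by (rule derivative_eq_intros der'[OF t(2) t'] refl | simp)+
          then have "(F i j has_field_derivative
            of_nat (Suc N) * (t - s) ^ N * P t $ i $ j + (t - s) ^ Suc N * (commutator (C t) (P t) $ i $ j / (t - s))) (at t)"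
            by (rule has_field_derivative_transform_within_open[of _ _ _ "ball s r - {s}"])
               (use t F(2) in auto)
          from DERIV_imp_deriv[OF this] show ?thesis
            using t(2) by (simp add: Q_def commutator_cscale field_simps)
        qed
        have "((\<lambda>t. of_nat (Suc N) * Q t $ i $ j + commutator (C t) (Q t) $ i $ j) \<longlongrightarrow> (s - s) * deriv (F i j) s) (at s)"
          by (rule Lim_transform_within_open[OF d0, of "ball s r"]) (use r d1 in auto)
        then have lim0: "((\<lambda>t. of_nat (Suc N) * Q t $ i $ j + commutator (C t) (Q t) $ i $ j) \<longlongrightarrow> 0) (at s)"
          by simp
        have "((\<lambda>t. of_nat (Suc N) * Q t $ i $ j + commutator (C t) (Q t) $ i $ j) \<longlongrightarrow>
            of_nat (Suc N) * X $ i $ j + commutator M X $ i $ j) (at s)"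
          by (intro tendsto_intros QX C)
        from tendsto_unique[OF _ this lim0] have "of_nat (Suc N) * X $ i $ j + commutator M X $ i $ j = 0"
          by simp
        then show ?thesis by (simp add: scaleR_conv_of_real)
      qed
      then show "real (Suc N) *\<^sub>R X + commutator M X = 0" by (simp add: vec_eq_iff)
    qed
    have "((\<lambda>t. cscale ((t - s) ^ N) (P t)) \<longlongrightarrow> (\<chi> i j. deriv (F i j) s)) (at s)"
      unfolding matrix_tendsto_iff
    proof (intro allI)
      fix i j
      have "(F i j has_field_derivative deriv (F i j) s) (at s)"
        using F(1)[of i j] r by (intro holomorphic_derivI) auto
      then have "((\<lambda>t. (F i j t - F i j s) / (t - s)) \<longlongrightarrow> deriv (F i j) s) (at s)"
        by (simp add: has_field_derivative_iff)
      moreover have "F i j s = 0" using \<open>X = 0\<close> by (simp add: X_def vec_eq_iff)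
      ultimately have "((\<lambda>t. F i j t / (t - s)) \<longlongrightarrow> deriv (F i j) s) (at s)" by simp
      then show "((\<lambda>t. cscale ((t - s) ^ N) (P t) $ i $ j) \<longlongrightarrow> (\<chi> i j. deriv (F i j) s) $ i $ j) (at s)"
        by (simp, elim Lim_transform_within_open[of _ _ _ _ "ball s r"])
           (use r F(2) in \<open>auto simp: Q_def\<close>)
    qed
    from order_tendstoD(2)[OF tendsto_norm[OF this], of "norm (\<chi> i j. deriv (F i j) s) + 1"]
    have "\<exists>B. \<forall>\<^sub>F t in at s. norm (t - s) ^ N * norm (P t) \<le> B"
      by (auto simp: norm_cscale norm_power intro: less_imp_le elim!: eventually_mono)
    then show ?case by (rule Suc.IH)
  qed

  obtain K where K: "K > 0" "\<And>(A :: complex ^ 'n ^ 'n) (B :: complex ^ 'n ^ 'n). norm (commutator A B) \<le> norm A * norm B * K"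
    using norm_commutator_le by metis
  obtain N where N: "(norm M + 1) * K \<le> real N" using real_arch_simple by blast
  have "\<exists>B. \<forall>\<^sub>F t in at s. norm (t - s) ^ N * norm (P t) \<le> B"
  proof (rule moderate_growth[OF r, where W = "\<lambda>t. cscale (1 / (t - s)) (commutator (C t) (P t))"])
    fix t assume t: "t \<noteq> s" "dist t s < r"
    show "((\<lambda>t. P t $ i $ j) has_field_derivative cscale (1 / (t - s)) (commutator (C t) (P t)) $ i $ j) (at t)" for i j
      using der'[OF t] by simp
    have "norm (commutator (C t) (P t)) \<le> norm (C t) * norm (P t) * K" by (rule K)
    also have "\<dots> \<le> (norm M + 1) * norm (P t) * K"
      using Cb[OF t] K(1) by (intro mult_right_mono) auto
    also have "\<dots> = (norm M + 1) * K * norm (P t)" by simp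
    also have "\<dots> \<le> real N * norm (P t)" using N by (intro mult_right_mono) auto
    finally show "norm (cscale (1 / (t - s)) (commutator (C t) (P t))) * norm (t - s) \<le> real N * norm (P t)"
      using t by (simp add: norm_cscale norm_divide)
  qed
  then show ?thesis by (rule pole)
qed

text \<open>The poles are removable, so the entries are entire with a limit at infinity: Liouville applies.\<close>

lemma nonresonant_fuchsian_constant:
  fixes P :: "complex \<Rightarrow> complex ^ 'n::finite ^ 'n" and s :: "'i \<Rightarrow> complex" and M :: "'i \<Rightarrow> complex ^ 'n ^ 'n"
  assumes fin: "finite I" and inj: "inj_on s I"
    and der: "\<And>t i j. t \<notin> s ` I \<Longrightarrow> ((\<lambda>t. P t $ i $ j) has_field_derivative
      commutator (\<Sum>k\<in>I. cscale (1 / (t - s k)) (M k)) (P t) $ i $ j) (at t)"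
    and nonres: "\<And>k m X. \<lbrakk>k \<in> I; m > 0; real m *\<^sub>R X + commutator (M k) X = 0\<rbrakk> \<Longrightarrow> X = 0"
    and lim: "(P \<longlongrightarrow> L) at_infinity" and t: "t \<notin> s ` I"
  shows "P t = L"
proof -
  have finS: "finite (s ` I)" using fin by simp
  have conv: "\<exists>L. (P \<longlongrightarrow> L) (at (s k))" if k: "k \<in> I" for k
  proof (rule nonresonant_singularity_removable)
    let ?C = "\<lambda>t. cscale (t - s k) (\<Sum>l\<in>I. cscale (1 / (t - s l)) (M l))"
    show "(?C \<longlongrightarrow> M k) (at (s k))"
      unfolding matrix_tendsto_iff
    proof (intro allI)
      fix i j
      have "((\<lambda>t. (t - s k) * (\<Sum>l\<in>I. M l $ i $ j / (t - s l))) \<longlongrightarrow> M k $ i $ j) (at (s k))"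
        using residue_limit[OF fin inj k, of "\<lambda>l. M l $ i $ j"] .
      then show "((\<lambda>t. ?C t $ i $ j) \<longlongrightarrow> M k $ i $ j) (at (s k))" by simp
    qed
    have "\<forall>\<^sub>F t in at (s k). t \<notin> s ` I"
      by (rule eventually_notin_finite) (rule finS)
    then show "\<forall>\<^sub>F t in at (s k). \<forall>i j. ((\<lambda>t. P t $ i $ j) has_field_derivative
      commutator (?C t) (P t) $ i $ j / (t - s k)) (at t)"
    proof eventually_elim
      case (elim t)
      then have "t \<noteq> s k" using k by auto
      then show ?case using der[OF elim] by (simp add: commutator_cscale)
    qed
  qed (use nonres k in blast)
  \<comment> \<open>\<open>Z\<close> is the entire extension of \<open>P\<close>.\<close>
  define Z where "Z x = (if x \<in> s ` I then Lim (at x) P else P x)" for x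
  have Zlim: "(P \<longlongrightarrow> Z x) (at x)" if x: "x \<in> s ` I" for x
  proof -
    obtain L' where L': "(P \<longlongrightarrow> L') (at x)" using x conv by auto
    then have "Lim (at x) P = L'" by (intro tendsto_Lim) auto
    with L' x show ?thesis by (simp add: Z_def)
  qed
  have "Z t $ i $ j = L $ i $ j" for i j
  proof (rule Liouville_weak[of "\<lambda>t. Z t $ i $ j" "L $ i $ j" t])
    show "(\<lambda>t. Z t $ i $ j) holomorphic_on UNIV"
    proof (rule no_isolated_singularity'[of "s ` I" "\<lambda>t. Z t $ i $ j"])
      fix x assume x: "x \<in> s ` I"
      have "\<forall>\<^sub>F y in at x. P y = Z y"
        using eventually_notin_finite[OF finS, of x] by eventually_elim (simp add: Z_def)
      then have "(Z \<longlongrightarrow> Z x) (at x)" by (rule Lim_transform_eventually[OF Zlim[OF x]])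
      then show "((\<lambda>t. Z t $ i $ j) \<longlongrightarrow> Z x $ i $ j) (at x within UNIV)"
        by (simp add: matrix_tendsto_iff)
    next
      have "(\<lambda>t. P t $ i $ j) holomorphic_on UNIV - s ` I"
      proof (rule holomorphic_onI)
        fix x assume "x \<in> UNIV - s ` I"
        then have "x \<notin> s ` I" by simp
        from der[OF this] show "(\<lambda>t. P t $ i $ j) field_differentiable at x within UNIV - s ` I"
          unfolding field_differentiable_def by (blast intro: has_field_derivative_at_within)
      qed
      then show "(\<lambda>t. Z t $ i $ j) holomorphic_on UNIV - s ` I"
        by (rule holomorphic_transform) (simp add: Z_def)
    qed (use finS in auto)
    have "\<forall>\<^sub>F x in at_infinity. P x = Z x"
    proof -
      obtain b where b: "\<And>y. y \<in> s ` I \<Longrightarrow> norm y \<le> b"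
        using finite_imp_bounded[OF finS] by (auto simp: bounded_iff)
      show ?thesis unfolding eventually_at_infinity
        by (rule exI[of _ "b + 1"]) (use b in \<open>force simp: Z_def\<close>)
    qed
    then have "(Z \<longlongrightarrow> L) at_infinity" by (rule Lim_transform_eventually[OF lim])
    then show "((\<lambda>t. Z t $ i $ j) \<longlongrightarrow> L $ i $ j) at_infinity" by (simp add: matrix_tendsto_iff)
  qed
  then show ?thesis using t by (simp add: Z_def vec_eq_iff)
qed

section \<open>Residues of flat and torsion free connections\<close>

lemma matrix_vector_mult_nth: "(A *v x) $ i = (\<Sum>j\<in>UNIV. A $ i $ j * x $ j)"
  by (simp add: matrix_vector_mult_def)

lemma cscale_mult_vec: "cscale c A *v x = c *s (A *v x)"
  by (simp add: vec_eq_iff matrix_vector_mult_nth sum_distrib_left mult.assoc)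

lemma sum_mult_vec: "(\<Sum>i\<in>I. A i) *v x = (\<Sum>i\<in>I. A i *v (x :: complex ^ 'n::finite))"
  by (induction I rule: infinite_finite_induct) (simp_all add: matrix_vector_mult_add_rdistrib)

lemma mat_mult_vec: "mat c *v x = c *s (x :: complex ^ 'n::finite)"
proof -
  have "(if i = j then c else 0) * x $ j = (if i = j then c * x $ j else 0)" for i j by simp
  then show ?thesis by (simp add: vec_eq_iff matrix_vector_mult_nth mat_def)
qed

lemma linear_functional_bounded:
  fixes f :: "complex ^ 'n::finite \<Rightarrow> complex"
  assumes "linear_functional f"
  shows "bounded_linear f"
proof -
  have "linear f"
  proof (rule linearI)
    fix r :: real and x :: "complex ^ 'n"
    have "r *\<^sub>R x = complex_of_real r *s x" by (simp add: vec_eq_iff scaleR_conv_of_real[where 'a = complex])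
    then show "f (r *\<^sub>R x) = r *\<^sub>R f x"
      by (simp add: linear_functional_simps[OF assms] scaleR_conv_of_real)
  qed (rule linear_functional_simps[OF assms])
  then show ?thesis by (simp add: linear_conv_bounded_linear)
qed

lemma linear_functional_derivative:
  assumes "linear_functional f"
  shows "(f has_derivative f) F"
  using linear_functional_bounded[OF assms] by (rule bounded_linear_imp_has_derivative)

lemma open_arr_complement:
  assumes "arrangement HH h"
  shows "open (arr_complement HH)"
proof -
  have "closed H" if "H \<in> HH" for H
  proof -
    have "H = h H -` {0}" using arrangementD(4)[OF assms that] by auto
    moreover have "continuous_on UNIV (h H)"
      using linear_functional_bounded[OF arrangementD(2)[OF assms that]] linear_continuous_on by blast
    ultimately show ?thesis by (metis closed_singleton continuous_closed_vimage continuous_on_eq_continuous_at open_UNIV UNIV_I)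
  qed
  then show ?thesis
    unfolding arr_complement_def using arrangementD(1)[OF assms] by (auto intro!: open_Diff closed_Union)
qed

definition connection_form ::
    "(complex ^ 'n::finite) set set \<Rightarrow> ((complex ^ 'n) set \<Rightarrow> complex ^ 'n \<Rightarrow> complex)
      \<Rightarrow> ((complex ^ 'n) set \<Rightarrow> complex ^ 'n ^ 'n) \<Rightarrow> complex ^ 'n \<Rightarrow> complex ^ 'n \<Rightarrow> complex ^ 'n ^ 'n" where
  "connection_form HH h A x v = (\<Sum>H\<in>HH. cscale (h H v / h H x) (A H))"

lemma connection_form_mult_vec:
  "connection_form HH h A x v *v w = (\<Sum>H\<in>HH. (h H v / h H x) *s (A H *v w))"
  by (simp add: connection_form_def sum_mult_vec cscale_mult_vec)

lemma connection_form_cscale: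
  assumes "arrangement HH h"
  shows "connection_form HH h A x (c *s v) = cscale c (connection_form HH h A x v)"
  using arrangementD(2)[OF assms]
  by (simp add: connection_form_def vec_eq_iff linear_functional_simps sum_distrib_left mult.assoc)

lemma smooth_on_const: "smooth_on U (\<lambda>_. c)"
proof -
  have "differentiable_times_on k U (\<lambda>_. c)" for k
    by (induction k arbitrary: c) (simp_all add: frechet_derivative_const)
  then show ?thesis by (simp add: smooth_on_def)
qed

lemma cov_deriv_const: "cov_deriv HH h A X (\<lambda>_. v) x = - (connection_form HH h A x (X x) *v v)"
  by (simp add: cov_deriv_def connection_form_mult_vec frechet_derivative_const)

lemma lie_bracket_const: "lie_bracket (\<lambda>_. u) (\<lambda>_. v) = (\<lambda>_. 0)"
  by (simp add: lie_bracket_def fun_eq_iff frechet_derivative_const)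

text \<open>Taking residues of the torsion \<open>\<Omega>(u) v - \<Omega>(v) u\<close> shows that each residue vanishes on its hyperplane.\<close>

lemma torsion_free_residue:
  assumes arr: "arrangement HH h" and tf: "torsion_free HH h A" and H: "H \<in> HH"
  shows "h H u *s (A H *v v) = h H v *s (A H *v u)"
proof -
  have *: "connection_form HH h A x u *v v = connection_form HH h A x v *v u" if "x \<in> arr_complement HH" for x
  proof -
    have "cov_deriv HH h A (\<lambda>_. u) (\<lambda>_. v) x - cov_deriv HH h A (\<lambda>_. v) (\<lambda>_. u) x
        - lie_bracket (\<lambda>_. u) (\<lambda>_. v) x = 0"
      using tf that smooth_on_const unfolding torsion_free_def Let_def by blast
    then show ?thesis by (simp add: cov_deriv_const lie_bracket_const)
  qed
  have "h H u * (A H *v v) $ i - h H v * (A H *v u) $ i = 0" for i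
  proof (rule log_forms_independent[OF arr _ H, of "\<lambda>H. h H u * (A H *v v) $ i - h H v * (A H *v u) $ i"])
    fix x assume "x \<in> arr_complement HH"
    from arg_cong[OF *[OF this], of "\<lambda>v. v $ i"]
    show "(\<Sum>H\<in>HH. (h H u * (A H *v v) $ i - h H v * (A H *v u) $ i) / h H x) = 0"
      by (simp add: connection_form_mult_vec diff_divide_distrib sum_subtractf)
  qed
  then show ?thesis by (simp add: vec_eq_iff)
qed

lemma residue_rank_one:
  assumes arr: "arrangement HH h" and tf: "torsion_free HH h A" and H: "H \<in> HH"
  obtains n where "\<And>v. A H *v v = h H v *s n" and "h H n = trace (A H)"
proof -
  obtain u where u: "h H u = 1"
    using linear_functional_normalize[OF arrangementD(2,3)[OF arr H]] .
  define n where "n = A H *v u"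
  have eq: "A H *v v = h H v *s n" for v
    using torsion_free_residue[OF arr tf H, of u v] u by (simp add: n_def)
  have "A H $ i $ i = h H (axis i 1) * n $ i" for i
    using arg_cong[OF eq[of "axis i 1"], of "\<lambda>v. v $ i"]
    by (simp add: matrix_vector_mult_nth axis_def if_distrib cong: if_cong)
  then have "trace (A H) = h H n"
    by (simp add: trace_def linear_functional_sum_axis[OF arrangementD(2)[OF arr H], of n] mult.commute)
  with eq that show thesis by metis
qed

text \<open>
  As \<open>d\<Omega> = 0\<close>, flatness says that the values of \<open>\<Omega>\<close> at a point commute. One of them, on the Euler
  field, is the sum of all residues; residues of the others then commute with it.
\<close>

lemma flat_connection_form_commute:
  assumes arr: "arrangement HH h" and flat: "flat_connection HH h A" and x: "x \<in> arr_complement HH"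
  shows "commutator (connection_form HH h A x u) (connection_form HH h A x v) = 0"
proof -
  let ?O = "connection_form HH h A x"
  have hx: "h H x \<noteq> 0" if "H \<in> HH" for H using x that by (simp add: arr_complement_iff[OF arr])
  \<comment> \<open>The derivative of the connection form is symmetric in the two directions, so it cancels from the
    curvature.\<close>
  have D2: "cov_deriv HH h A (\<lambda>_. u) (cov_deriv HH h A (\<lambda>_. v) (\<lambda>_. w)) x =
      (\<Sum>H\<in>HH. (h H u * h H v / (h H x)\<^sup>2) *s (A H *v w)) + ?O u *v (?O v *v w)" for u v w
  proof -
    let ?f = "\<lambda>p. \<Sum>H\<in>HH. (h H v / h H p) *s (A H *v w)"
    let ?f' = "\<lambda>z. \<Sum>H\<in>HH. (- (h H z * h H v / (h H x)\<^sup>2)) *s (A H *v w)"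
    have "(?f has_derivative ?f') (at x)"
    proof (rule has_derivative_sum)
      fix H assume H: "H \<in> HH"
      have bl: "bounded_linear (\<lambda>c. c *s (A H *v w))"
        unfolding linear_conv_bounded_linear[symmetric]
        by (rule linearI) (simp_all add: vec_eq_iff algebra_simps)
      have "((\<lambda>p. h H v / h H p) has_derivative (\<lambda>z. - (h H z * h H v / (h H x)\<^sup>2))) (at x)"
        by (rule has_derivative_eq_rhs[OF has_derivative_divide[OF has_derivative_const
              linear_functional_derivative[OF arrangementD(2)[OF arr H]] hx[OF H]]])
           (simp add: fun_eq_iff divide_inverse power2_eq_square)
      from bounded_linear.has_derivative[OF bl this]
      show "((\<lambda>p. (h H v / h H p) *s (A H *v w)) has_derivative
             (\<lambda>z. (- (h H z * h H v / (h H x)\<^sup>2)) *s (A H *v w))) (at x)" .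
    qed
    then have "((\<lambda>p. - ?f p) has_derivative (\<lambda>z. - ?f' z)) (at x)"
      by (rule has_derivative_minus)
    then have "frechet_derivative (\<lambda>p. - ?f p) (at x) = (\<lambda>z. - ?f' z)"
      by (rule frechet_derivative_at[symmetric])
    moreover have "cov_deriv HH h A (\<lambda>_. v) (\<lambda>_. w) = (\<lambda>p. - ?f p)"
      by (simp add: fun_eq_iff cov_deriv_const connection_form_mult_vec)
    ultimately have "cov_deriv HH h A (\<lambda>_. u) (cov_deriv HH h A (\<lambda>_. v) (\<lambda>_. w)) x =
        - ?f' u - (?O u *v (- (?O v *v w)))"
      by (simp add: cov_deriv_def connection_form_mult_vec)
    also have "\<dots> = - ?f' u + ?O u *v (?O v *v w)"
      by (simp add: matrix_vector_mult_nth vec_eq_iff sum_negf)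
    also have "- ?f' u = (\<Sum>H\<in>HH. (h H u * h H v / (h H x)\<^sup>2) *s (A H *v w))"
      by (simp add: sum_negf[symmetric] vec_eq_iff)
    finally show ?thesis .
  qed
  have "?O u *v (?O v *v w) = ?O v *v (?O u *v w)" for w
  proof -
    have "cov_deriv HH h A (\<lambda>_. u) (cov_deriv HH h A (\<lambda>_. v) (\<lambda>_. w)) x
        - cov_deriv HH h A (\<lambda>_. v) (cov_deriv HH h A (\<lambda>_. u) (\<lambda>_. w)) x
        - cov_deriv HH h A (lie_bracket (\<lambda>_. u) (\<lambda>_. v)) (\<lambda>_. w) x = 0"
      using flat x smooth_on_const unfolding flat_connection_def Let_def by blast
    moreover have "cov_deriv HH h A (\<lambda>_. 0) (\<lambda>_. w) x = 0"
      using arrangementD(2)[OF arr]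
      by (simp add: cov_deriv_const connection_form_mult_vec linear_functional_simps)
    ultimately show ?thesis by (simp add: D2 lie_bracket_const mult.commute)
  qed
  then have "(?O u ** ?O v) *v w = (?O v ** ?O u) *v w" for w
    by (simp add: matrix_vector_mul_assoc)
  then have "?O u ** ?O v = ?O v ** ?O u" by (simp add: matrix_eq)
  then show ?thesis by (simp add: commutator_def)
qed

lemma connection_form_euler:
  assumes "arrangement HH h" "x \<in> arr_complement HH"
  shows "connection_form HH h A x x = (\<Sum>H\<in>HH. A H)"
  unfolding connection_form_def
  by (rule sum.cong) (use assms in \<open>auto simp: arr_complement_iff vec_eq_iff\<close>)

lemma residues_commute:
  assumes arr: "arrangement HH h" and H: "H \<in> HH"
    and comm: "\<And>x u. x \<in> arr_complement HH \<Longrightarrow> commutator (connection_form HH h A x u) B = 0"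
  shows "commutator (A H) B = 0"
proof -
  obtain u where u: "h H u = 1"
    using linear_functional_normalize[OF arrangementD(2,3)[OF arr H]] .
  have "h H u * commutator (A H) B $ i $ j = 0" for i j
  proof (rule log_forms_independent[OF arr _ H, of "\<lambda>H. h H u * commutator (A H) B $ i $ j"])
    fix x assume "x \<in> arr_complement HH"
    from arg_cong[OF comm[OF this, of u], of "\<lambda>M. M $ i $ j"]
    show "(\<Sum>H\<in>HH. h H u * commutator (A H) B $ i $ j / h H x) = 0"
      by (simp add: connection_form_def commutator_sum commutator_cscale)
  qed
  then show ?thesis using u by (simp add: vec_eq_iff)
qed

section \<open>Matrices commuting with all residues\<close>

text \<open>
  Eigenvectors for different eigenvalues are independent, here for the operator \<open>f \<mapsto> f \<circ> M\<close>: for the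
  eigenvalue \<open>\<nu>\<close> of a generator \<open>k\<close>, the operator minus \<open>\<nu>\<close> multiplies \<open>f\<close> by the nonzero number
  \<open>\<mu> - \<nu>\<close> and kills \<open>k\<close>, so \<open>f\<close> already lies in the span of the other generators.
\<close>

lemma eigenfunctional_span:
  fixes B :: "(complex ^ 'n::finite \<Rightarrow> complex) set"
  assumes "finite B" and "\<And>k. k \<in> B \<Longrightarrow> \<exists>\<nu>. \<nu> \<noteq> \<mu> \<and> (\<forall>v. k (M *v v) = \<nu> * k v)"
    and "f \<in> functional.span B" and "\<And>v. f (M *v v) = \<mu> * f v"
  shows "f = 0"
  using assms
proof (induction B arbitrary: f rule: finite_induct)
  case empty
  then show ?case by simp
next
  case (insert k B)
  obtain \<nu> where \<nu>: "\<nu> \<noteq> \<mu>" "\<And>v. k (M *v v) = \<nu> * k v"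
    using insert.prems(1) by blast
  obtain c where c: "f - scale_functional c k \<in> functional.span B"
    using insert.prems(2) by (auto simp: functional.span_breakdown_eq)
  define f' where "f' = f - scale_functional c k"
  have inv: "(\<lambda>v. a (M *v v)) \<in> functional.span B" if "a \<in> functional.span B" for a
    using that
  proof (induction rule: functional.span_induct_alt)
    case base
    then show ?case using functional.span_zero by (simp add: zero_fun_def)
  next
    case (step d b a)
    obtain \<rho> where "\<And>v. b (M *v v) = \<rho> * b v" using insert.prems(1) step(1) by blast
    then have "(\<lambda>v. (scale_functional d b + a) (M *v v)) =
        scale_functional (d * \<rho>) b + (\<lambda>v. a (M *v v))"
      by (simp add: fun_eq_iff scale_functional_def)
    then show ?case
      using step by (simp add: functional.span_add functional.span_scale functional.span_base)
  qed
  have "scale_functional (\<mu> - \<nu>) f = (\<lambda>v. f' (M *v v)) - scale_functional \<nu> f'"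
    using \<nu>(2) insert.prems(3) by (simp add: fun_eq_iff f'_def scale_functional_def algebra_simps)
  also have "\<dots> \<in> functional.span B"
    using inv[OF c] c by (simp add: f'_def functional.span_diff functional.span_scale)
  finally have "scale_functional (1 / (\<mu> - \<nu>)) (scale_functional (\<mu> - \<nu>) f) \<in> functional.span B"
    by (rule functional.span_scale)
  then have "f \<in> functional.span B" using \<nu>(1) by (simp add: scale_functional_def)
  then show ?case using insert by blast
qed

text \<open>
  A matrix commuting with a rank one residue has its linear form as a left eigenvector. The
  eigenvalues that occur split the equations into directly summed families, so irreducibility leaves
  a single eigenvalue \<open>\<mu>\<close>. Then \<open>M - \<mu>\<close> maps into every hyperplane, hence to \<open>0\<close>.
\<close>

lemma commuting_with_residues_scalar:
  fixes HH :: "(complex ^ 'n::finite) set set"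
  assumes arr: "arrangement HH h" and ess: "essential HH" and irr: "\<not> reducible h HH"
    and rank1: "\<And>H. H \<in> HH \<Longrightarrow> \<exists>n. (\<forall>v. A H *v v = h H v *s n) \<and> h H n \<noteq> 0"
    and comm: "\<And>H. H \<in> HH \<Longrightarrow> commutator (A H) M = 0"
  shows "\<exists>c. M = mat c"
proof -
  note l = arrangementD(2)[OF arr]
  have "\<exists>\<mu>. \<forall>v. h H (M *v v) = \<mu> * h H v" if H: "H \<in> HH" for H
  proof -
    obtain n where n: "\<And>v. A H *v v = h H v *s n" "h H n \<noteq> 0" using rank1[OF H] by blast
    have "A H ** M = M ** A H" using comm[OF H] by (simp add: commutator_def)
    then have "A H *v (M *v v) = M *v (A H *v v)" for v
      by (simp add: matrix_vector_mul_assoc)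
    then have "h H (M *v v) *s n = M *v (h H v *s n)" for v by (simp add: n(1))
    then have *: "h H (M *v v) *s n = h H v *s (M *v n)" for v
      by (simp add: vec.scale)
    have "h H (M *v v) * h H n = h H v * h H (M *v n)" for v
      using arg_cong[OF *[of v], of "h H"] by (simp add: linear_functional_simps[OF l[OF H]])
    then have "h H (M *v v) = h H (M *v n) / h H n * h H v" for v
      using n(2) by (simp add: field_simps)
    then show ?thesis by blast
  qed
  then obtain \<mu> where \<mu>: "\<And>H v. H \<in> HH \<Longrightarrow> h H (M *v v) = \<mu> H * h H v" by metis
  have "HH \<noteq> {}"
  proof
    assume "HH = {}"
    then have "(UNIV :: (complex ^ 'n) set) = {0}" using ess by (simp add: essential_def)
    then have "axis undefined 1 = (0 :: complex ^ 'n)" by blast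
    then show False by (simp add: axis_eq_0_iff)
  qed
  then obtain H0 where H0: "H0 \<in> HH" by blast
  define B1 where "B1 = {H \<in> HH. \<mu> H = \<mu> H0}"
  define B2 where "B2 = {H \<in> HH. \<mu> H \<noteq> \<mu> H0}"
  have B: "HH = B1 \<union> B2" "B1 \<noteq> {}" using H0 by (auto simp: B1_def B2_def)
  have "B2 = {}"
  proof (rule ccontr)
    assume ne: "B2 \<noteq> {}"
    have "f = 0" if f: "f \<in> equation_span h B1" "f \<in> equation_span h B2" for f
    proof (rule eigenfunctional_span)
      show "finite (h ` B2)" using arrangementD(1)[OF arr] by (simp add: B2_def)
      show "f \<in> functional.span (h ` B2)" using f(2) by (simp add: equation_span_def)
      show "\<exists>\<nu>. \<nu> \<noteq> \<mu> H0 \<and> (\<forall>v. k (M *v v) = \<nu> * k v)" if "k \<in> h ` B2" for k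
        using that \<mu> by (auto simp: B2_def)
      have "\<forall>v. f (M *v v) = \<mu> H0 * f v"
        using f(1) unfolding equation_span_def
      proof (induction rule: functional.span_induct_alt)
        case (step c b a)
        then obtain H where "H \<in> B1" "b = h H" by blast
        then have "b (M *v v) = \<mu> H0 * b v" for v using \<mu> by (simp add: B1_def)
        then show ?case using step(2) by (simp add: scale_functional_def algebra_simps)
      qed simp
      then show "f (M *v v) = \<mu> H0 * f v" for v by blast
    qed
    moreover have "0 \<in> equation_span h B1" "0 \<in> equation_span h B2"
      by (simp_all add: equation_span_def functional.span_zero)
    ultimately have "equation_span h B1 \<inter> equation_span h B2 = {0}" by blast
    moreover have "equation_span h HH = {a + b | a b. a \<in> equation_span h B1 \<and> b \<in> equation_span h B2}"
      unfolding equation_span_def B(1) image_Un functional.span_Un by blast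
    ultimately have "reducible h HH"
      unfolding reducible_def internal_direct_sum_def using B ne by blast
    with irr show False ..
  qed
  have "h H (M *v v - \<mu> H0 *s v) = 0" if H: "H \<in> HH" for H v
  proof -
    have "\<mu> H = \<mu> H0" using H \<open>B2 = {}\<close> unfolding B2_def by blast
    then show ?thesis using \<mu>[OF H, of v] by (simp add: linear_functional_simps[OF l[OF H]])
  qed
  then have "M *v v - \<mu> H0 *s v \<in> \<Inter>HH" for v
    using arrangementD(4)[OF arr] by blast
  then have "M *v v - \<mu> H0 *s v = 0" for v
    using ess unfolding essential_def by blast
  then have "M *v v = mat (\<mu> H0) *v v" for v
    by (simp add: mat_mult_vec)
  then have "M = mat (\<mu> H0)" by (simp add: matrix_eq)
  then show ?thesis by blast
qed

section \<open>Weights of hyperplanes\<close>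

lemma dim_hyperplane:
  fixes f :: "complex ^ 'n::finite \<Rightarrow> complex"
  assumes f: "linear_functional f" "f \<noteq> 0"
  shows "CARD('n) - vec.dim {x. f x = 0} = 1"
proof -
  let ?K = "{x. f x = 0}"
  obtain u where u: "f u = 1" using linear_functional_normalize[OF f] .
  have sub: "vec.subspace ?K"
    by (auto simp: vec.subspace_def linear_functional_simps[OF f(1)])
  have nu: "u \<notin> vec.span ?K"
    unfolding vec.span_eq_iff[THEN iffD2, OF sub] using u by simp
  have "x \<in> vec.span (insert u ?K)" for x
  proof -
    have "x - f x *s u \<in> ?K" using u by (simp add: linear_functional_simps[OF f(1)])
    then have "(x - f x *s u) + f x *s u \<in> vec.span (insert u ?K)"
      by (intro vec.span_add vec.span_scale vec.span_base) auto
    then show ?thesis by simp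
  qed
  then have "vec.span (insert u ?K) = UNIV" by blast
  then have "vec.dim (insert u ?K) = CARD('n)"
    by (metis vec.dim_span vec_dim_card)
  then show ?thesis using nu by (simp add: vec.dim_insert)
qed

text \<open>Through the hyperplanes themselves, conditions on the weights become conditions on traces of residues.\<close>

lemma hyperplane_irreducible_intersection:
  fixes HH :: "(complex ^ 'n::finite) set set"
  assumes arr: "arrangement HH h" and H: "H \<in> HH"
  shows "H \<in> irreducible_intersections HH h" and "weight HH A H = trace (A H)"
proof -
  have loc: "localization HH H = {H}"
    using H hyperplane_subset_imp_eq[OF arr H] by (auto simp: localization_def)
  have "H \<noteq> UNIV"
    using arrangementD(3,4)[OF arr H] by (auto simp: fun_eq_iff)
  moreover have "H \<in> intersections HH"
    unfolding intersections_def using H by (intro CollectI exI[of _ "{H}"]) auto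
  moreover have "\<not> reducible h {H}"
  proof
    assume "reducible h {H}"
    then obtain B1 B2 where *: "B1 \<noteq> {}" "B2 \<noteq> {}" "{H} = B1 \<union> B2"
      and zero: "equation_span h B1 \<inter> equation_span h B2 = {0}"
      by (auto simp: reducible_def internal_direct_sum_def)
    from * have "B1 = {H}" "B2 = {H}" by (metis Un_upper1 subset_singletonD, metis Un_upper2 subset_singletonD)
    then have "h H \<in> equation_span h B1 \<inter> equation_span h B2"
      by (auto simp: equation_span_def intro: functional.span_base)
    then show False using zero arrangementD(3)[OF arr H] by simp
  qed
  ultimately show "H \<in> irreducible_intersections HH h"
    by (simp add: irreducible_intersections_def loc)
  have "H = {x. h H x = 0}" using arrangementD(4)[OF arr H] by blast
  then have "CARD('n) - vec.dim H = 1"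
    using dim_hyperplane[OF arrangementD(2,3)[OF arr H]] by simp
  then show "weight HH A H = trace (A H)"
    by (simp add: weight_def loc)
qed

text \<open>
  The commutator with \<open>A\<close> has only the eigenvalues \<open>0\<close>, \<open>f n\<close> and \<open>- f n\<close>, so a negative integer is not
  among them. Concretely, the equation is evaluated on \<open>n\<close> and composed with \<open>f\<close>.
\<close>

lemma rank_one_nonresonant:
  fixes f :: "complex ^ 'n::finite \<Rightarrow> complex"
  assumes f: "linear_functional f" and A: "\<And>v. A *v v = f v *s n"
    and a: "f n \<notin> \<int>" and m: "m > 0" and X: "real m *\<^sub>R X + commutator A X = 0"
  shows "X = 0"
proof -
  have ne: "of_nat m - f n \<noteq> 0" "of_nat m + f n \<noteq> 0"
  proof -
    show "of_nat m - f n \<noteq> 0" using a Ints_of_nat[of m] by (metis eq_iff_diff_eq_0)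
    show "of_nat m + f n \<noteq> 0"
    proof
      assume "of_nat m + f n = 0"
      then have "f n = - of_nat m" by (simp add: eq_neg_iff_add_eq_0 add.commute)
      then show False using a by simp
    qed
  qed
  have eq: "of_nat m *s (X *v v) + (f (X *v v) *s n - f v *s (X *v n)) = 0" for v
  proof -
    have "(real m *\<^sub>R X + commutator A X) *v v =
        complex_of_nat m *s (X *v v) + (A *v (X *v v) - X *v (A *v v))"
      by (simp add: commutator_def matrix_vector_mult_add_rdistrib matrix_vector_mult_diff_rdistrib
            matrix_vector_mul_assoc vec_eq_iff matrix_vector_mult_nth
            scaleR_conv_of_real[where 'a = complex] sum_distrib_left mult.assoc)
    then show ?thesis using X by (simp add: A vec.scale)
  qed
  have feq: "of_nat m * f (X *v v) + (f (X *v v) * f n - f v * f (X *v n)) = 0" for v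
    using arg_cong[OF eq[of v], of f] by (simp add: linear_functional_simps[OF f])
  have "of_nat m * f (X *v n) = 0" using feq[of n] by (simp add: algebra_simps)
  then have fXn: "f (X *v n) = 0" using m by simp
  have "(of_nat m - f n) *s (X *v n) = 0"
    using eq[of n] fXn by (simp add: vec_eq_iff algebra_simps)
  then have Xn: "X *v n = 0" using ne by simp
  have "X *v v = 0" for v
  proof -
    have "(of_nat m + f n) * f (X *v v) = 0" using feq[of v] fXn by (simp add: algebra_simps)
    then have "f (X *v v) = 0" using ne by simp
    then have "of_nat m *s (X *v v) = 0" using eq[of v] Xn by simp
    then show ?thesis using m by simp
  qed
  then show ?thesis by (simp add: matrix_eq)
qed

section \<open>Comparing two parallel metrics\<close>

lemma matrix_inv_mult:
  fixes A :: "complex ^ 'n::finite ^ 'n"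
  assumes "invertible A"
  shows "matrix_inv A ** A = mat 1" "A ** matrix_inv A = mat 1"
proof -
  have "\<exists>B. A ** B = mat 1 \<and> B ** A = mat 1" using assms by (simp add: invertible_def)
  from someI_ex[OF this] show "matrix_inv A ** A = mat 1" "A ** matrix_inv A = mat 1"
    by (simp_all add: matrix_inv_def)
qed

lemma tendsto_det:
  fixes f :: "'a \<Rightarrow> complex ^ 'n::finite ^ 'n"
  assumes "\<And>i j. ((\<lambda>x. f x $ i $ j) \<longlongrightarrow> L $ i $ j) F"
  shows "((\<lambda>x. det (f x)) \<longlongrightarrow> det L) F"
  unfolding det_def by (intro tendsto_intros assms)

text \<open>By Cramer's rule the entries of the inverse are quotients of determinants.\<close>

lemma tendsto_matrix_inv:
  fixes f :: "'a \<Rightarrow> complex ^ 'n::finite ^ 'n"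
  assumes lim: "(f \<longlongrightarrow> L) F" and inv: "\<forall>\<^sub>F x in F. invertible (f x)" "invertible L"
  shows "((\<lambda>x. matrix_inv (f x)) \<longlongrightarrow> matrix_inv L) F"
proof -
  have entry: "matrix_inv A $ k $ j =
      det (\<chi> i l. if l = k then axis j 1 $ i else A $ i $ l) / det A"
    if A: "invertible A" for A :: "complex ^ 'n ^ 'n" and k j
  proof -
    have "A *v (matrix_inv A *v axis j 1) = axis j 1"
      using matrix_inv_mult(2)[OF A] by (simp add: matrix_vector_mul_assoc)
    then have "matrix_inv A *v axis j 1 =
        (\<chi> k. det (\<chi> i l. if l = k then axis j 1 $ i else A $ i $ l) / det A)"
      using cramer[of A "matrix_inv A *v axis j 1" "axis j 1"] A by (simp add: invertible_det_nz)
    from arg_cong[OF this, of "\<lambda>v. v $ k"] show ?thesis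
      by (simp add: matrix_vector_mult_nth axis_def if_distrib cong: if_cong)
  qed
  have lim': "((\<lambda>x. f x $ i $ j) \<longlongrightarrow> L $ i $ j) F" for i j
    using lim by (simp add: matrix_tendsto_iff)
  show ?thesis
    unfolding matrix_tendsto_iff
  proof (intro allI)
    fix k j
    have "((\<lambda>x. det (\<chi> i l. if l = k then axis j 1 $ i else f x $ i $ l) / det (f x)) \<longlongrightarrow>
        det (\<chi> i l. if l = k then axis j 1 $ i else L $ i $ l) / det L) F"
      using inv(2) lim' by (intro tendsto_divide tendsto_det) (auto simp: invertible_det_nz)
    then show "((\<lambda>x. matrix_inv (f x) $ k $ j) \<longlongrightarrow> matrix_inv L $ k $ j) F"
      unfolding entry[OF inv(2)]
      by (rule Lim_transform_eventually) (use inv(1) in eventually_elim, simp add: entry)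
  qed
qed

text \<open>
  The ratio \<open>K\<^sup>-\<^sup>1 K'\<close> of two solutions of \<open>dK = - (K \<Omega> + \<Omega>\<^sup>* K)\<close> solves \<open>dP = [\<Omega>, P]\<close>: the
  antiholomorphic term cancels, so the ratio is holomorphic although \<open>K\<close> and \<open>K'\<close> are not. It suffices to
  differentiate \<open>K' - K P\<^sub>0\<close> for the coeff \<open>P\<^sub>0\<close> at the point.
\<close>

lemma parallel_ratio_derivative:
  fixes K K' :: "complex \<Rightarrow> complex ^ 'n::finite ^ 'n" and D :: "complex \<Rightarrow> complex ^ 'n ^ 'n"
  defines "P \<equiv> \<lambda>t. matrix_inv (K t) ** K' t"
  assumes dK: "\<And>i j. ((\<lambda>t. K t $ i $ j) has_derivative (\<lambda>\<tau>. - (K s ** cscale \<tau> W + D \<tau> ** K s) $ i $ j)) (at s)"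
    and dK': "\<And>i j. ((\<lambda>t. K' t $ i $ j) has_derivative (\<lambda>\<tau>. - (K' s ** cscale \<tau> W + D \<tau> ** K' s) $ i $ j)) (at s)"
    and inv: "\<forall>\<^sub>F t in at s. invertible (K t)" "invertible (K s)"
  shows "((\<lambda>t. P t $ i $ j) has_field_derivative commutator W (P s) $ i $ j) (at s)"
proof -
  define P0 where "P0 = P s"
  define N where "N t = K' t - K t ** P0" for t
  have K'0: "K' s = K s ** P0"
    by (simp add: P0_def P_def matrix_mul_assoc matrix_inv_mult[OF inv(2)])
  then have N0: "N s = 0" by (simp add: N_def)
  have dN: "((\<lambda>t. N t $ i $ j) has_field_derivative (K s ** commutator W P0) $ i $ j) (at s)" for i j
  proof -
    have deriv: "((\<lambda>t. K' t $ i $ j - (\<Sum>k\<in>UNIV. K t $ i $ k * P0 $ k $ j)) has_derivative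
        (\<lambda>\<tau>. - (K' s ** cscale \<tau> W + D \<tau> ** K' s) $ i $ j
           - (\<Sum>k\<in>UNIV. - (K s ** cscale \<tau> W + D \<tau> ** K s) $ i $ k * P0 $ k $ j))) (at s)"
      by (intro derivative_intros dK dK')
    have coeff: "- (K' s ** cscale \<tau> W + D \<tau> ** K' s) $ i $ j
           - (\<Sum>k\<in>UNIV. - (K s ** cscale \<tau> W + D \<tau> ** K s) $ i $ k * P0 $ k $ j) =
        (K s ** commutator W P0) $ i $ j * \<tau>" for \<tau>
    proof -
      have sum: "(\<Sum>k\<in>UNIV. - (K s ** cscale \<tau> W + D \<tau> ** K s) $ i $ k * P0 $ k $ j) =
          - (((K s ** cscale \<tau> W + D \<tau> ** K s) ** P0) $ i $ j)"
        unfolding matrix_mult_nth[of _ P0] mult_minus_left sum_negf ..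
      have "(K s ** cscale \<tau> W + D \<tau> ** K s) ** P0 - (K' s ** cscale \<tau> W + D \<tau> ** K' s) =
          cscale \<tau> (K s ** commutator W P0)"
        by (simp add: K'0 commutator_def matrix_mult.add_left matrix_mult.diff_right matrix_mult_cscale
              cscale_diff matrix_mul_assoc)
      from arg_cong[OF this, of "\<lambda>M. M $ i $ j"] show ?thesis
        unfolding sum by (simp add: algebra_simps)
    qed
    have "((\<lambda>t. K' t $ i $ j - (\<Sum>k\<in>UNIV. K t $ i $ k * P0 $ k $ j)) has_derivative
        (\<lambda>\<tau>. (K s ** commutator W P0) $ i $ j * \<tau>)) (at s)"
      by (rule has_derivative_eq_rhs[OF deriv ext]) (rule coeff)
    then show ?thesis
      unfolding has_field_derivative_def N_def matrix_mult_nth[of _ P0] vector_minus_component .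
  qed
  have contK: "(K \<longlongrightarrow> K s) (at s)"
    unfolding matrix_tendsto_iff
  proof (intro allI)
    fix i j
    show "((\<lambda>t. K t $ i $ j) \<longlongrightarrow> K s $ i $ j) (at s)"
      using has_derivative_continuous[OF dK[of i j]] by (simp add: continuous_at)
  qed
  have "((\<lambda>t. \<Sum>k\<in>UNIV. matrix_inv (K t) $ i $ k * ((N t $ k $ j - N s $ k $ j) / (t - s))) \<longlongrightarrow>
      (\<Sum>k\<in>UNIV. matrix_inv (K s) $ i $ k * (K s ** commutator W P0) $ k $ j)) (at s)"
  proof (intro tendsto_sum tendsto_mult)
    fix k
    show "((\<lambda>t. matrix_inv (K t) $ i $ k) \<longlongrightarrow> matrix_inv (K s) $ i $ k) (at s)"
      using tendsto_matrix_inv[OF contK inv] by (simp add: matrix_tendsto_iff)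
    show "((\<lambda>t. (N t $ k $ j - N s $ k $ j) / (t - s)) \<longlongrightarrow> (K s ** commutator W P0) $ k $ j) (at s)"
      using dN by (simp add: has_field_derivative_iff)
  qed
  moreover have "(\<Sum>k\<in>UNIV. matrix_inv (K s) $ i $ k * (K s ** commutator W P0) $ k $ j) = commutator W P0 $ i $ j"
    unfolding matrix_mult_nth[symmetric] by (simp add: matrix_mul_assoc matrix_inv_mult[OF inv(2)])
  moreover have "\<forall>\<^sub>F t in at s. (\<Sum>k\<in>UNIV. matrix_inv (K t) $ i $ k * ((N t $ k $ j - N s $ k $ j) / (t - s))) =
      (P t $ i $ j - P s $ i $ j) / (t - s)"
    using inv(1)
  proof eventually_elim
    case (elim t)
    have "matrix_inv (K t) ** N t = P t - P0"
      by (simp add: N_def P_def matrix_mult.diff_right matrix_mul_assoc matrix_inv_mult[OF elim])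
    from arg_cong[OF this, of "\<lambda>M. M $ i $ j"]
    show ?case by (simp add: N0 matrix_mult_nth[of _ "N t"] P0_def sum_divide_distrib[symmetric])
  qed
  ultimately have "((\<lambda>t. (P t $ i $ j - P s $ i $ j) / (t - s)) \<longlongrightarrow> commutator W P0 $ i $ j) (at s)"
    by (simp add: Lim_transform_eventually)
  then show ?thesis by (simp add: has_field_derivative_iff P0_def)
qed

text \<open>The order of the indices makes \<open>g x u v = v\<^sup>* (gram g x) u\<close>.\<close>

definition gram ::
    "(complex ^ 'n::finite \<Rightarrow> complex ^ 'n \<Rightarrow> complex ^ 'n \<Rightarrow> complex) \<Rightarrow> complex ^ 'n \<Rightarrow> complex ^ 'n ^ 'n" where
  "gram g x = (\<chi> i j. g x (axis j 1) (axis i 1))"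

context
  fixes U :: "(complex ^ 'n::finite) set" and g x
  assumes herm: "hermitian_metric_on U g" and x: "x \<in> U"
begin

lemma hermitian_linear: "linear_functional (\<lambda>u. g x u v)"
  and hermitian_symmetric: "g x v u = cnj (g x u v)"
  and hermitian_positive: "u \<noteq> 0 \<Longrightarrow> 0 < g x u u"
  using herm x unfolding hermitian_metric_on_def by blast+

lemma hermitian_gram_right: "g x u (axis i 1) = (gram g x *v u) $ i"
  using linear_functional_sum_axis[OF hermitian_linear[of "axis i 1"], of u]
  by (simp add: gram_def matrix_vector_mult_nth mult.commute)

lemma hermitian_gram: "g x u v = (\<Sum>i\<in>UNIV. cnj (v $ i) * (gram g x *v u) $ i)"
proof -
  have "g x u v = cnj (g x v u)" by (rule hermitian_symmetric)
  also have "g x v u = (\<Sum>i\<in>UNIV. v $ i * g x (axis i 1) u)"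
    by (rule linear_functional_sum_axis[OF hermitian_linear])
  also have "cnj \<dots> = (\<Sum>i\<in>UNIV. cnj (v $ i) * g x u (axis i 1))"
    by (simp add: hermitian_symmetric[of u])
  finally show ?thesis by (simp add: hermitian_gram_right)
qed

lemma gram_invertible: "invertible (gram g x)"
proof -
  have "u = 0" if "gram g x *v u = 0" for u
  proof (rule ccontr)
    assume "u \<noteq> 0"
    then have "0 < g x u u" by (rule hermitian_positive)
    then show False using that by (simp add: hermitian_gram)
  qed
  then show ?thesis
    by (simp add: invertible_left_inverse matrix_left_invertible_ker)
qed

end

text \<open>The equation \<open>dK = - (K \<Omega> + \<Omega>\<^sup>* K)\<close>: parallelism tested on the coordinate fields.\<close>

lemma gram_derivative:
  assumes herm: "hermitian_metric_on (arr_complement HH) g" and par: "parallel_metric HH h A g"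
    and x: "x \<in> arr_complement HH"
  defines "\<Omega> \<equiv> connection_form HH h A x"
  shows "((\<lambda>p. gram g p $ i $ j) has_derivative
    (\<lambda>z. - (gram g x ** \<Omega> z + (\<chi> i k. cnj (\<Omega> z $ k $ i)) ** gram g x) $ i $ j)) (at x)"
proof -
  note lin = hermitian_linear[OF herm x] and sym = hermitian_symmetric[OF herm x]
    and gr = hermitian_gram[OF herm x] and gri = hermitian_gram_right[OF herm x]
  have "differentiable_times_on (Suc 0) (arr_complement HH) (\<lambda>p. g p (axis j 1) (axis i 1))"
    using herm unfolding hermitian_metric_on_def smooth_on_def by blast
  then have "(\<lambda>p. gram g p $ i $ j) differentiable at x"
    using x by (simp add: gram_def)
  then have "((\<lambda>p. gram g p $ i $ j) has_derivative frechet_derivative (\<lambda>p. gram g p $ i $ j) (at x)) (at x)"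
    by (simp add: frechet_derivative_works)
  moreover have "frechet_derivative (\<lambda>p. gram g p $ i $ j) (at x) z =
      - (gram g x ** \<Omega> z + (\<chi> i k. cnj (\<Omega> z $ k $ i)) ** gram g x) $ i $ j" for z
  proof -
    let ?j = "axis j 1 :: complex ^ 'a" and ?i = "axis i 1 :: complex ^ 'a"
    have ax: "(\<Omega> z *v axis k 1) $ l = \<Omega> z $ l $ k" "(gram g x *v axis k 1) $ l = gram g x $ l $ k" for k l
      by (simp_all add: matrix_vector_mult_nth axis_def if_distrib cong: if_cong)
    have "frechet_derivative (\<lambda>p. g p ?j ?i) (at x) z =
        g x (cov_deriv HH h A (\<lambda>_. z) (\<lambda>_. ?j) x) ?i + g x ?j (cov_deriv HH h A (\<lambda>_. z) (\<lambda>_. ?i) x)"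
      by (rule par[unfolded parallel_metric_def Let_def, rule_format,
            OF smooth_on_const smooth_on_const smooth_on_const x])
    also have "\<dots> = g x (- (\<Omega> z *v ?j)) ?i + g x ?j (- (\<Omega> z *v ?i))"
      by (simp add: cov_deriv_const \<Omega>_def)
    also have "g x (- (\<Omega> z *v ?j)) ?i = - (gram g x ** \<Omega> z) $ i $ j"
      by (simp add: gri matrix_vector_mult_nth[of "gram g x"] ax matrix_mult_nth sum_negf)
    also have "g x ?j (- (\<Omega> z *v ?i)) = - ((\<chi> i k. cnj (\<Omega> z $ k $ i)) ** gram g x) $ i $ j"
      by (simp add: gr ax matrix_mult_nth sum_negf)
    finally show ?thesis by (simp add: gram_def)
  qed
  ultimately show ?thesis by (metis (no_types, lifting) ext)
qed

text \<open>The endomorphism field \<open>P\<close> with \<open>g' u v = g (P u) v\<close>, written as a matrix.\<close>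

definition metric_ratio ::
    "(complex ^ 'n::finite \<Rightarrow> complex ^ 'n \<Rightarrow> complex ^ 'n \<Rightarrow> complex)
      \<Rightarrow> (complex ^ 'n \<Rightarrow> complex ^ 'n \<Rightarrow> complex ^ 'n \<Rightarrow> complex) \<Rightarrow> complex ^ 'n \<Rightarrow> complex ^ 'n ^ 'n" where
  "metric_ratio g g' x = matrix_inv (gram g x) ** gram g' x"

lemma line_derivative: "((\<lambda>t. p + t *s q) has_derivative (\<lambda>\<tau>. \<tau> *s (q :: complex ^ 'n::finite))) F"
proof -
  have "bounded_linear (\<lambda>t. t *s q)"
    unfolding linear_conv_bounded_linear[symmetric]
    by (rule linearI) (simp_all add: vec_eq_iff algebra_simps)
  from has_derivative_add[OF has_derivative_const bounded_linear_imp_has_derivative[OF this], of p F]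
  show ?thesis by simp
qed

lemma eventually_on_line:
  assumes "arrangement HH h" "p + s *s q \<in> arr_complement HH"
  shows "\<forall>\<^sub>F t in at s. p + t *s q \<in> arr_complement HH"
proof (rule topological_tendstoD)
  show "((\<lambda>t. p + t *s q) \<longlongrightarrow> p + s *s q) (at s)"
    using has_derivative_continuous[OF line_derivative[of p q "at s"]] by (simp add: continuous_at)
qed (use open_arr_complement assms in auto)

lemma metric_ratio_on_line:
  assumes arr: "arrangement HH h"
    and g: "hermitian_metric_on (arr_complement HH) g" "parallel_metric HH h A g"
    and g': "hermitian_metric_on (arr_complement HH) g'" "parallel_metric HH h A g'"
    and x: "p + s *s q \<in> arr_complement HH"
  shows "((\<lambda>t. metric_ratio g g' (p + t *s q) $ i $ j) has_field_derivative
    commutator (connection_form HH h A (p + s *s q) q) (metric_ratio g g' (p + s *s q)) $ i $ j) (at s)"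
  unfolding metric_ratio_def
proof (rule parallel_ratio_derivative)
  let ?\<Omega> = "connection_form HH h A (p + s *s q)"
  have dG: "((\<lambda>t. gram g (p + t *s q) $ i $ j) has_derivative
      (\<lambda>\<tau>. - (gram g (p + s *s q) ** cscale \<tau> (?\<Omega> q)
        + (\<chi> i k. cnj (?\<Omega> (\<tau> *s q) $ k $ i)) ** gram g (p + s *s q)) $ i $ j)) (at s)"
    if "hermitian_metric_on (arr_complement HH) g" "parallel_metric HH h A g" for g i j
    using has_derivative_compose[OF line_derivative gram_derivative[OF that x]]
    by (simp only: connection_form_cscale[OF arr])
  show "((\<lambda>t. gram g (p + t *s q) $ i $ j) has_derivative
      (\<lambda>\<tau>. - (gram g (p + s *s q) ** cscale \<tau> (?\<Omega> q)
        + (\<chi> i k. cnj (?\<Omega> (\<tau> *s q) $ k $ i)) ** gram g (p + s *s q)) $ i $ j)) (at s)" for i j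
    by (rule dG[OF g])
  show "((\<lambda>t. gram g' (p + t *s q) $ i $ j) has_derivative
      (\<lambda>\<tau>. - (gram g' (p + s *s q) ** cscale \<tau> (?\<Omega> q)
        + (\<chi> i k. cnj (?\<Omega> (\<tau> *s q) $ k $ i)) ** gram g' (p + s *s q)) $ i $ j)) (at s)" for i j
    by (rule dG[OF g'])
  show "\<forall>\<^sub>F t in at s. invertible (gram g (p + t *s q))"
    using eventually_on_line[OF arr x] by eventually_elim (rule gram_invertible[OF g(1)])
  show "invertible (gram g (p + s *s q))" by (rule gram_invertible[OF g(1) x])
qed

lemma commutator_mat: "commutator (mat c) M = 0"
proof -
  have "(mat c ** M) *v v = (M ** mat c) *v v" for v
    by (simp only: matrix_vector_mul_assoc[symmetric] mat_mult_vec vec.scale)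
  then have "mat c ** M = M ** mat c" by (simp add: matrix_eq)
  then show ?thesis by (simp add: commutator_def)
qed

theorem corollary1p5:
  fixes HH :: "(complex ^ 'n::finite) set set"
    and h :: "(complex ^ 'n) set \<Rightarrow> complex ^ 'n \<Rightarrow> complex"
    and A :: "(complex ^ 'n) set \<Rightarrow> complex ^ 'n ^ 'n"
    and g g' :: "complex ^ 'n \<Rightarrow> complex ^ 'n \<Rightarrow> complex ^ 'n \<Rightarrow> complex"
  assumes "arrangement HH h" and "essential HH" and "\<not> reducible h HH"
    and "flat_connection HH h A" and "torsion_free HH h A" and "unitary_connection HH h A"
    and "\<And>L. L \<in> irreducible_intersections HH h \<Longrightarrow> weight HH A L \<notin> \<int>"
    and "\<And>L. L \<in> irreducible_intersections HH h \<Longrightarrow> 1 - weight HH A L > 0"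
    and "kaehler_metric_on (arr_complement HH) g" and "parallel_metric HH h A g"
    and "kaehler_metric_on (arr_complement HH) g'" and "parallel_metric HH h A g'"
  shows "\<exists>c::real. c > 0 \<and>
    (\<forall>x\<in>arr_complement HH. \<forall>u v. g' x u v = complex_of_real c * g x u v)"
proof -
  let ?U = "arr_complement HH"
  note arr = assms(1)
  note l = arrangementD(2)[OF arr]
  have g: "hermitian_metric_on ?U g" "parallel_metric HH h A g"
    and g': "hermitian_metric_on ?U g'" "parallel_metric HH h A g'"
    using assms by (auto simp: kaehler_metric_on_def)
  define P where "P = metric_ratio g g'"
  note dP = metric_ratio_on_line[OF arr g g', folded P_def]

  have rank1: "\<exists>n. (\<forall>v. A H *v v = h H v *s n) \<and> h H n \<notin> \<int>" if H: "H \<in> HH" for H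
  proof -
    obtain n where n: "\<And>v. A H *v v = h H v *s n" "h H n = trace (A H)"
      using residue_rank_one[OF arr assms(5) H] by blast
    have "trace (A H) \<notin> \<int>"
      using assms(7)[OF hyperplane_irreducible_intersection(1)[OF arr H]]
        hyperplane_irreducible_intersection(2)[OF arr H, of A] by simp
    with n show ?thesis by auto
  qed
  have scalar: "\<exists>c. M = mat c" if "\<And>H. H \<in> HH \<Longrightarrow> commutator (A H) M = 0" for M
  proof (rule commuting_with_residues_scalar[OF arr assms(2,3) _ that])
    fix H assume "H \<in> HH"
    then obtain n where "\<forall>v. A H *v v = h H v *s n" "h H n \<notin> \<int>" using rank1 by blast
    then show "\<exists>n. (\<forall>v. A H *v v = h H v *s n) \<and> h H n \<noteq> 0" by (metis Ints_0)
  qed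

  \<comment> \<open>The connection form on the Euler field is a scalar, so it does not act on endomorphisms.\<close>
  have "commutator (A H) (\<Sum>H\<in>HH. A H) = 0" if "H \<in> HH" for H
    using residues_commute[OF arr that, of A "\<Sum>H\<in>HH. A H"]
      flat_connection_form_commute[OF arr assms(4)] connection_form_euler[OF arr, of _ A] by metis
  then obtain a0 where a0: "(\<Sum>H\<in>HH. A H) = mat a0" using scalar by blast

  have scale: "c *s x \<in> ?U" if "x \<in> ?U" "c \<noteq> 0" for c x
    using that by (auto simp: arr_complement_iff[OF arr] linear_functional_simps[OF l])

  have homogeneous: "P (c *s x) = P x" if x: "x \<in> ?U" and c: "c \<noteq> 0" for c x
  proof -
    have "P (c *s x) $ i $ j = P x $ i $ j" for i j
    proof (rule DERIV_zero_connected_constant[where S = "- {0}" and K = "{}" and f = "\<lambda>t. P (t *s x) $ i $ j"])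
      show "connected (- {0 :: complex})" by (rule connected_punctured_universe) simp
      have deriv: "((\<lambda>t. P (t *s x) $ i $ j) has_field_derivative 0) (at t)" if "t \<noteq> 0" for t
      proof -
        have tx: "t *s x \<in> ?U" by (rule scale[OF x that])
        have "cscale t (commutator (connection_form HH h A (t *s x) x) (P (t *s x))) =
            commutator (connection_form HH h A (t *s x) (t *s x)) (P (t *s x))"
          by (simp add: connection_form_cscale[OF arr] commutator_cscale)
        also have "\<dots> = 0"
          unfolding connection_form_euler[OF arr tx] a0 by (rule commutator_mat)
        finally have "commutator (connection_form HH h A (t *s x) x) (P (t *s x)) = 0"
          using that by (simp add: vec_eq_iff)
        then show ?thesis using dP[of 0 t x i j] tx by simp
      qed
      show "continuous_on (- {0}) (\<lambda>t. P (t *s x) $ i $ j)"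
        using deriv by (auto intro!: continuous_at_imp_continuous_on DERIV_isCont)
      show "\<forall>t\<in>- {0} - {}. ((\<lambda>t. P (t *s x) $ i $ j) has_field_derivative 0) (at t)"
        using deriv by auto
      fix k assume k: "\<And>t. t \<in> - {0} \<Longrightarrow> P (t *s x) $ i $ j = k"
      show "P (c *s x) $ i $ j = P x $ i $ j" using k[of c] k[of 1] c by simp
    qed auto
    then show ?thesis by (simp add: vec_eq_iff)
  qed

  \<comment> \<open>On the line through \<open>p\<close> in direction \<open>q\<close>, homogeneity turns \<open>t \<rightarrow> \<infinity>\<close> into approaching \<open>q\<close>, since
    \<open>(p + t q) / t = q + p / t\<close>.\<close>
  have generic_const: "P p = P q" if gen: "generic_pair HH h p q" for p q
  proof -
    have p: "p \<in> ?U" and q: "q \<in> ?U" using gen by (auto simp: generic_pair_def)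
    have hq: "h H q \<noteq> 0" if "H \<in> HH" for H using q that by (simp add: arr_complement_iff[OF arr])
    define s where "s H = crossing (h H) p q" for H
    have on_line: "p + t *s q \<in> ?U" if "t \<notin> s ` HH" for t
      using that log_form_on_line(2)[OF l hq] by (auto simp: arr_complement_iff[OF arr] s_def)
    have "P (p + 0 *s q) = P q"
    proof (rule nonresonant_fuchsian_constant[where I = HH and s = s and M = A and P = "\<lambda>t. P (p + t *s q)"])
      show "finite HH" by (rule arrangementD(1)[OF arr])
      show "inj_on s HH" using inj_on_crossing[OF arr gen] by (simp add: s_def[abs_def])
      show "0 \<notin> s ` HH"
        using p hq by (auto simp: s_def crossing_def arr_complement_iff[OF arr])
      show "X = 0" if "H \<in> HH" "m > 0" "real m *\<^sub>R X + commutator (A H) X = 0" for H m X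
        using rank1[OF that(1)] rank_one_nonresonant[OF l[OF that(1)]] that(2,3) by blast
    next
      fix t i j assume t: "t \<notin> s ` HH"
      have "connection_form HH h A (p + t *s q) q = (\<Sum>H\<in>HH. cscale (1 / (t - s H)) (A H))"
        unfolding connection_form_def s_def
        by (rule sum.cong) (use log_form_on_line(1)[OF l hq] in auto)
      then show "((\<lambda>t. P (p + t *s q) $ i $ j) has_field_derivative
          commutator (\<Sum>H\<in>HH. cscale (1 / (t - s H)) (A H)) (P (p + t *s q)) $ i $ j) (at t)"
        using dP[OF on_line[OF t]] by simp
    next
      have "((\<lambda>t. P (q + inverse t *s p)) \<longlongrightarrow> P q) at_infinity"
        unfolding matrix_tendsto_iff
      proof (intro allI)
        fix i j
        have "isCont (\<lambda>t. P (q + t *s p) $ i $ j) 0"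
          using dP[of q 0 p i j] q by (auto intro: DERIV_isCont)
        from isCont_tendsto_compose[OF this tendsto_inverse_0]
        show "((\<lambda>t. P (q + inverse t *s p) $ i $ j) \<longlongrightarrow> P q $ i $ j) at_infinity" by simp
      qed
      moreover have "\<forall>\<^sub>F t in at_infinity. P (q + inverse t *s p) = P (p + t *s q)"
      proof -
        have "finite (insert 0 (s ` HH))" using arrangementD(1)[OF arr] by simp
        then obtain b where b: "\<And>t. t \<in> insert 0 (s ` HH) \<Longrightarrow> norm t \<le> b"
          using finite_imp_bounded by (metis bounded_iff)
        have "P (q + inverse t *s p) = P (p + t *s q)" if "norm t \<ge> b + 1" for t
        proof -
          have t: "t \<noteq> 0" "t \<notin> s ` HH" using b[of t] that by auto
          have "q + inverse t *s p = inverse t *s (p + t *s q)"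
            using t(1) by (simp add: vec_eq_iff field_simps)
          then show ?thesis using homogeneous[OF on_line[OF t(2)], of "inverse t"] t(1) by (metis inverse_zero_imp_zero)
        qed
        then show ?thesis unfolding eventually_at_infinity by blast
      qed
      ultimately show "((\<lambda>t. P (p + t *s q)) \<longlongrightarrow> P q) at_infinity"
        by (rule Lim_transform_eventually)
    qed
    then show ?thesis by simp
  qed
  have P_const: "P x = P y" if "x \<in> ?U" "y \<in> ?U" for x y
  proof -
    have "finite {x, y}" "{x, y} \<subseteq> ?U" using that by auto
    from generic_point_exists[OF arr this]
    obtain p where "generic_pair HH h p x" "generic_pair HH h p y" by (metis insertCI)
    then show ?thesis using generic_const by metis
  qed
  \<comment> \<open>A constant solution commutes with the connection form, hence with its residues.\<close>
  obtain x0 where x0: "x0 \<in> ?U" using generic_point_exists[OF arr, of "{}"] by auto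
  have "commutator (connection_form HH h A x u) (P x0) = 0" if x: "x \<in> ?U" for x u
  proof -
    have "commutator (connection_form HH h A x u) (P x) $ i $ j = 0" for i j
    proof -
      have "((\<lambda>t. P (x + t *s u) $ i $ j) has_field_derivative
          commutator (connection_form HH h A x u) (P x) $ i $ j) (at 0)"
        using dP[of x 0 u i j] x by simp
      moreover have "((\<lambda>t. P (x + t *s u) $ i $ j) has_field_derivative 0) (at 0)"
      proof -
        have ev: "\<forall>\<^sub>F t in nhds 0. P (x + t *s u) $ i $ j = P x0 $ i $ j"
          unfolding eventually_nhds_conv_at
          using eventually_on_line[OF arr, of x 0 u] P_const[OF _ x0] x
          by (auto elim!: eventually_mono)
        show ?thesis
          by (subst DERIV_cong_ev[OF refl ev refl]) simp
      qed
      ultimately show ?thesis by (rule DERIV_unique)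
    qed
    then show ?thesis using P_const[OF x x0] by (simp add: vec_eq_iff)
  qed
  then obtain c where c: "P x0 = mat c" using scalar residues_commute[OF arr] by meson
  have eq: "g' x u v = c * g x u v" if x: "x \<in> ?U" for x u v
  proof -
    have "gram g' x = gram g x ** P x"
      by (simp add: P_def metric_ratio_def matrix_mul_assoc matrix_inv_mult[OF gram_invertible[OF g(1) x]])
    also have "P x = mat c" using P_const[OF x x0] c by simp
    finally have "gram g' x *v u = c *s (gram g x *v u)"
      by (simp add: matrix_vector_mul_assoc[symmetric] mat_mult_vec vec.scale)
    then show ?thesis
      by (simp add: hermitian_gram[OF g(1) x] hermitian_gram[OF g'(1) x] sum_distrib_left mult.left_commute)
  qed
  have "(axis undefined 1 :: complex ^ 'n) \<noteq> 0" by (simp add: axis_eq_0_iff)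
  from hermitian_positive[OF g(1) x0 this] hermitian_positive[OF g'(1) x0 this] eq[OF x0]
  have pos: "0 < g x0 (axis undefined 1) (axis undefined 1)"
    "0 < c * g x0 (axis undefined 1) (axis undefined 1)" by simp_all
  then obtain r where r: "r > 0" "g x0 (axis undefined 1) (axis undefined 1) = complex_of_real r"
    by (metis complex_is_Real_iff less_complex_def of_real_Re zero_complex.sel)
  have "0 < Re c * r" "Im c * r = 0" using pos(2) r(2) by (auto simp: less_complex_def)
  then have "Re c > 0" "c = complex_of_real (Re c)"
    using r(1) by (auto simp: zero_less_mult_iff complex_eq_iff)
  then show ?thesis using eq by (metis)
qed

end
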